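(* Let $\mu$ be a finite positive Borel measure on $\overline{\mathbb D}$ and $\Psi_1,\Psi_2$ Orlicz functions. 1) If the identity maps $H^{\Psi_1}$ continuously into $L^{\Psi_2}(\mu)$, then there is $A>0$ with $\rho_\mu(h)\le\dfrac{1}{\Psi_2(A\Psi_1^{-1}(1/h))}$ for every $h\in(0,1]$. 2) If there is $A>0$ with $K_\mu(h)\le\dfrac{1/h}{\Psi_2(A\Psi_1^{-1}(1/h))}$ for every $h\in(0,1]$, then the identity maps $H^{\Psi_1}$ continuously into $L^{\Psi_2}(\mu)$.
   Context: An Orlicz function is a continuous, strictly convex, increasing $\Psi\colon[0,\infty)\to[0,\infty)$ with $\Psi(0)=0$ and $\Psi(x)/x\to\infty$. For a finite measure $\nu$, $L^\Psi(\nu)$ is the space of measurable $f$ with finite Luxemburg norm $\|f\|_{L^\Psi(\nu)}=\inf\{C>0:\int\Psi(|f|/C)\,d\nu\le1\}$. $H^\Psi$ = analytic $f$ on $\mathbb D$ with $\sup_{r<1}\|f(re^{i\cdot})\|_{L^\Psi(m)}<\infty$ ($m$ normalized measure on $\mathbb T$), with boundary function $f^*$; an $f\in H^\Psi$ is regarded as a function on $\overline{\mathbb D}$ equal to $f$ on $\mathbb D$ and $f^*$ on $\mathbb T$. Carleson window: $W(\xi,h)=\{z\in\overline{\mathbb D}:1-h<|z|\le1,\ |\arg(z\bar\xi)|<h\}$ for $\xi\in\mathbb T$, $h\in(0,1]$. $\rho_\mu(h)=\sup_{\xi\in\mathbb T}\mu(W(\xi,h))$ and $K_\mu(h)=\sup_{0<t\le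 h}\rho_\mu(t)/t$. *)

theory Defs
  imports "HOL-Analysis.Analysis"
begin

definition strictly_convex_on :: "real set \<Rightarrow> (real \<Rightarrow> real) \<Rightarrow> bool" where
  "strictly_convex_on S f \<longleftrightarrow>
     (\<forall>x\<in>S. \<forall>y\<in>S. \<forall>t::real. x \<noteq> y \<and> 0 < t \<and> t < 1 \<longrightarrow>
        f (t * x + (1 - t) * y) < t * f x + (1 - t) * f y)"

text \<open>Orlicz function on [0,oo) (values outside [0,oo) are irrelevant).\<close>
definition orlicz :: "(real \<Rightarrow> real) \<Rightarrow> bool" where
  "orlicz \<Psi> \<longleftrightarrow> continuous_on {0..} \<Psi> \<and> strictly_convex_on {0..} \<Psi>
     \<and> strict_mono_on {0..} \<Psi> \<and> (\<forall>x\<ge>0. \<Psi> x \<ge> 0) \<and> \<Psi> 0 = 0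
     \<and> filterlim (\<lambda>x. \<Psi> x / x) at_top at_top"

definition orlicz_inv :: "(real \<Rightarrow> real) \<Rightarrow> real \<Rightarrow> real" where
  "orlicz_inv \<Psi> y = (THE x. 0 \<le> x \<and> \<Psi> x = y)"

definition lux_norm :: "(real \<Rightarrow> real) \<Rightarrow> 'a measure \<Rightarrow> ('a \<Rightarrow> complex) \<Rightarrow> real" where
  "lux_norm \<Psi> \<nu> f = Inf {C. C > 0 \<and> (\<integral>\<^sup>+ x. ennreal (\<Psi> (norm (f x) / C)) \<partial>\<nu>) \<le> 1}"

definition in_orlicz :: "(real \<Rightarrow> real) \<Rightarrow> 'a measure \<Rightarrow> ('a \<Rightarrow> complex) \<Rightarrow> bool" where
  "in_orlicz \<Psi> \<nu> f \<longleftrightarrow> f \<in> borel_measurable \<nu> \<and>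
     (\<exists>C>0. (\<integral>\<^sup>+ x. ennreal (\<Psi> (norm (f x) / C)) \<partial>\<nu>) \<le> 1)"

text \<open>Normalized arc-length measure m on the unit circle, parametrized by
  theta in [0, 2 pi] via theta |-> cis theta.\<close>
definition circle_measure :: "real measure" where
  "circle_measure = density (restrict_space lborel {0..2*pi}) (\<lambda>_. ennreal (1 / (2*pi)))"

definition in_hardy_orlicz :: "(real \<Rightarrow> real) \<Rightarrow> (complex \<Rightarrow> complex) \<Rightarrow> bool" where
  "in_hardy_orlicz \<Psi> f \<longleftrightarrow> f holomorphic_on ball 0 1 \<and>
     (\<forall>r\<in>{0..<1}. in_orlicz \<Psi> circle_measure (\<lambda>\<theta>. f (of_real r * cis \<theta>))) \<and>
     bdd_above ((\<lambda>r. lux_norm \<Psi> circle_measure (\<lambda>\<theta>. f (of_real r * cis \<theta>))) ` {0..<1})"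

definition hardy_norm :: "(real \<Rightarrow> real) \<Rightarrow> (complex \<Rightarrow> complex) \<Rightarrow> real" where
  "hardy_norm \<Psi> f = (SUP r\<in>{0..<1}. lux_norm \<Psi> circle_measure (\<lambda>\<theta>. f (of_real r * cis \<theta>)))"

definition boundary_fun :: "(complex \<Rightarrow> complex) \<Rightarrow> complex \<Rightarrow> complex" where
  "boundary_fun f \<zeta> =
     (if \<exists>l. ((\<lambda>r::real. f (of_real r * \<zeta>)) \<longlongrightarrow> l) (at_left 1)
      then Lim (at_left 1) (\<lambda>r::real. f (of_real r * \<zeta>)) else 0)"

definition disc_ext :: "(complex \<Rightarrow> complex) \<Rightarrow> complex \<Rightarrow> complex" where
  "disc_ext f z = (if norm z < 1 then f z else boundary_fun f z)"

text \<open>The identity maps H^Psi1 continuously (boundedly, the map being linear) into L^Psi2(mu).\<close>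
definition hardy_orlicz_embeds ::
    "(real \<Rightarrow> real) \<Rightarrow> (real \<Rightarrow> real) \<Rightarrow> complex measure \<Rightarrow> bool" where
  "hardy_orlicz_embeds \<Psi>1 \<Psi>2 \<mu> \<longleftrightarrow>
     (\<forall>f. in_hardy_orlicz \<Psi>1 f \<longrightarrow> in_orlicz \<Psi>2 \<mu> (disc_ext f)) \<and>
     (\<exists>C. \<forall>f. in_hardy_orlicz \<Psi>1 f \<longrightarrow>
         lux_norm \<Psi>2 \<mu> (disc_ext f) \<le> C * hardy_norm \<Psi>1 f)"

definition carleson_window :: "complex \<Rightarrow> real \<Rightarrow> complex set" where
  "carleson_window \<xi> h = {z. 1 - h < norm z \<and> norm z \<le> 1 \<and> \<bar>Arg (z * cnj \<xi>)\<bar> < h}"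

definition rho_mu :: "complex measure \<Rightarrow> real \<Rightarrow> real" where
  "rho_mu \<mu> h = (SUP \<xi>\<in>sphere 0 1. measure \<mu> (carleson_window \<xi> h))"

definition K_mu :: "complex measure \<Rightarrow> real \<Rightarrow> ereal" where
  "K_mu \<mu> h = (SUP t\<in>{0<..h}. ereal (rho_mu \<mu> t / t))"

end

theory Submission
  imports Defs "HOL-Complex_Analysis.Complex_Analysis"
begin

text \<open>
  Necessity: test on \<open>u(z) = (h / (1 - (1 - h) cnj \<xi> z))\<^sup>2\<close>. On circles \<open>|u|\<close> is \<open>h\<^sup>2\<close> times a
  multiple of a Poisson kernel, so its mean is at most \<open>h\<close>; since \<open>|u| \<le> 1\<close>, convexity bounds its
  Hardy--Orlicz norm by \<open>1 / \<Psi>\<^sub>1\<^sup>-\<^sup>1(1/h)\<close>, while \<open>|u| \<ge> 1/9\<close> on the window.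

  Sufficiency: by Fatou's lemma it suffices to estimate the dilates \<open>g(z) = f(s z)\<close> for a
  sequence of \<open>s\<close> tending to 1, which can avoid the moduli of the zeros of \<open>f\<close>; points of the circle without
  radial limit do no harm, the extension being 0 there. Dividing out the zeros of \<open>g\<close> and taking a
  holomorphic square root, \<open>|g|\<^sup>1\<^sup>/\<^sup>2\<close> is dominated by the Poisson integral of its boundary values. The
  exponent 1/2 leaves room for a summation that fails for \<open>|g|\<close> itself, because no \<open>\<nabla>\<^sub>2\<close> condition is assumed. If
  \<open>|g(z)| > 4 \<tau>\<close>, some arc around \<open>z / |z|\<close> of length \<open>h \<ge> 1 - |z|\<close> carries
  \<open>|g|\<^sup>1\<^sup>/\<^sup>2\<close>-mass at least a multiple of \<open>h \<tau>\<^sup>1\<^sup>/\<^sup>2\<close> on the set where \<open>|g| > \<tau>\<close>. If the integral of \<open>\<Psi>\<^sub>1(|g|)\<close> is at most 1,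
  then \<open>h\<close> is at most a multiple of \<open>1 / \<Psi>\<^sub>1(\<tau>)\<close>, so only \<open>K\<^sub>\<mu>\<close> at this scale matters in the estimate of
  \<open>\<mu>(|g| > 4 \<tau>)\<close> given by the Vitali covering lemma. Summing over \<open>\<tau> = 4\<^sup>k \<tau>\<^sub>0\<close> against \<open>\<Psi>\<^sub>2\<close> cancels the factor
  \<open>\<Psi>\<^sub>2\<close> in the hypothesis and leaves the integral of \<open>\<Psi>\<^sub>1(|g|)\<close>.
\<close>

section \<open>Poisson integrals on the circle\<close>


lemma sets_circle_measure [measurable_cong]:
  "sets circle_measure = sets (restrict_space borel {0..2*pi})"
  unfolding circle_measure_def by (simp add: sets_restrict_space)

lemma measurable_circle_measureI:
  "F \<in> borel_measurable borel \<Longrightarrow> F \<in> borel_measurable circle_measure"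
  using measurable_restrict_space1[of F borel] measurable_cong_sets[OF sets_circle_measure refl] by blast

lemma nn_integral_circle_measure:
  fixes F :: "real \<Rightarrow> ennreal"
  assumes [measurable]: "F \<in> borel_measurable borel"
  shows "(\<integral>\<^sup>+\<theta>. F \<theta> \<partial>circle_measure) =
    ennreal (1 / (2*pi)) * (\<integral>\<^sup>+\<theta>. F \<theta> * indicator {0..2*pi} \<theta> \<partial>lborel)"
proof -
  have F: "F \<in> borel_measurable (restrict_space lborel {0..2*pi})"
    by (rule measurable_restrict_space1) simp
  show ?thesis
    unfolding circle_measure_def
    by (simp add: nn_integral_density[OF _ F] nn_integral_cmult F nn_integral_restrict_space)
qed

text \<open>Cauchy's formula yields gauge integrals over the parameter interval, while Luxemburg
  norms use nonnegative Lebesgue integrals against \<open>circle_measure\<close>; this is the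
  passage between the two.\<close>

lemma nn_integral_circle_measure_has_integral:
  fixes f :: "real \<Rightarrow> real"
  assumes "f \<in> borel_measurable borel" "\<And>\<theta>. 0 \<le> f \<theta>" "(f has_integral I) {0..2*pi}"
  shows "(\<integral>\<^sup>+\<theta>. ennreal (f \<theta>) \<partial>circle_measure) = ennreal (I / (2*pi))"
proof -
  have "(\<integral>\<^sup>+\<theta>. ennreal (f \<theta>) \<partial>circle_measure) = ennreal (1 / (2*pi)) * ennreal I"
    using assms by (subst nn_integral_circle_measure)
      (auto simp: nn_integral_has_integral_lebesgue')
  also have "\<dots> = ennreal (I / (2*pi))"
    by (subst ennreal_mult''[symmetric]) (use assms(2) has_integral_nonneg[OF assms(3)] in auto)
  finally show ?thesis .
qed

text \<open>For |e| = 1 the kernel has mean 1 against the probability measure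
  \<open>circle_measure\<close>, hence no factor 1 / (2 pi).\<close>

definition poisson_kernel :: "complex \<Rightarrow> complex \<Rightarrow> real" where
  "poisson_kernel z e = (1 - (norm z)\<^sup>2) / (norm (e - z))\<^sup>2"

lemma poisson_kernel_nonneg: "norm z \<le> 1 \<Longrightarrow> 0 \<le> poisson_kernel z e"
  by (simp add: poisson_kernel_def power_le_one)

text \<open>The two numbers agree up to conjugation and a unimodular factor.\<close>

lemma norm_cis_diff:
  "norm (cis \<theta> - z) = norm (1 - cnj z * cis \<theta>)"
proof -
  have "cnj (1 - cnj z * cis \<theta>) = cis (-\<theta>) * (cis \<theta> - z)"
    by (simp add: algebra_simps cis_mult cis_cnj)
  then have "norm (1 - cnj z * cis \<theta>) = norm (cis (-\<theta>) * (cis \<theta> - z))"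
    by (metis complex_mod_cnj)
  then show ?thesis by (simp add: norm_mult)
qed

lemma one_minus_cnj_mult_nonzero:
  assumes "norm z < 1" "norm w \<le> 1"
  shows "1 - cnj z * w \<noteq> 0"
proof
  assume "1 - cnj z * w = 0"
  then have "norm (cnj z * w) = 1" by (metis eq_iff_diff_eq_0 norm_one)
  then have "norm z * norm w = 1" by (simp add: norm_mult)
  moreover have "norm z * norm w \<le> norm z * 1" using assms by (intro mult_left_mono) auto
  ultimately show False using assms by simp
qed

lemma cis_ne_of_norm_less_1: "norm z < 1 \<Longrightarrow> cis \<theta> \<noteq> z"
  by auto

text \<open>Cauchy's formula applied to \<open>w \<mapsto> q w (1 - |z|\<^sup>2) / (1 - cnj z w)\<close>, which takes the value \<open>q z\<close> at \<open>z\<close>.\<close>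

lemma poisson_formula:
  assumes cont: "continuous_on (cball 0 1) q" and hol: "q holomorphic_on ball 0 1"
    and z: "norm z < 1"
  shows "((\<lambda>\<theta>. q (cis \<theta>) * of_real (poisson_kernel z (cis \<theta>))) has_integral of_real (2*pi) * q z) {0..2*pi}"
proof -
  define c where "c = (of_real (1 - (norm z)\<^sup>2) :: complex)"
  define F where "F = (\<lambda>w. q w * c / (1 - cnj z * w))"
  note nz = one_minus_cnj_mult_nonzero[OF z]
  have cF: "continuous_on (cball 0 1) F" unfolding F_def
    by (intro continuous_intros cont) (use nz in auto)
  have hF: "F holomorphic_on ball 0 1" unfolding F_def
    by (intro holomorphic_intros hol) (use nz in auto)
  \<comment> \<open>The factor c = 1 - |z|^2 cancels the denominator at w = z.\<close>
  have Fz: "F z = q z"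
  proof -
    have "c = 1 - cnj z * z"
      by (simp only: c_def mult.commute[of "cnj z" z] complex_mult_cnj of_real_diff cmod_power2) simp
    then show ?thesis using nz[of z] z by (simp add: F_def)
  qed
  have "((\<lambda>u. F u / (u - z)) has_contour_integral (2 * of_real pi * \<i> * F z)) (circlepath 0 1)"
    by (rule Cauchy_integral_circlepath[OF cF hF]) (use z in simp)
  then have "((\<lambda>t. F (0 + of_real 1 * cis t) / (0 + of_real 1 * cis t - z) * of_real 1 * \<i> * cis t) has_integral
      (2 * of_real pi * \<i> * F z)) {0..2*pi}"
    unfolding circlepath_def by (subst (asm) has_contour_integral_part_circlepath_iff) auto
  \<comment> \<open>Multiplication by -i turns the constant 2 pi i of Cauchy's formula into 2
    pi.\<close>
  from has_integral_mult_right[OF this, of "- \<i>"]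
  have "((\<lambda>t. - \<i> * (F (cis t) / (cis t - z) * \<i> * cis t)) has_integral of_real (2*pi) * q z) {0..2*pi}"
    by (simp add: Fz algebra_simps)
  then show ?thesis
  proof (rule has_integral_eq[rotated])
    fix t
    define n where "n = norm (cis t - z)"
    have nn: "n \<noteq> 0" using cis_ne_of_norm_less_1[OF z, of t] by (simp add: n_def)
    \<comment> \<open>On the circle the Cauchy denominator is cis t times the conjugate of the
      reflected one, so their product is cis t times the squared distance and the Poisson kernel
      appears.\<close>
    have e: "cis t - z = cis t * cnj (1 - cnj z * cis t)"
      by (simp add: algebra_simps cis_cnj cis_mult)
    have "(1 - cnj z * cis t) * cnj (1 - cnj z * cis t) = of_real (n\<^sup>2)"
      unfolding n_def norm_cis_diff complex_norm_square by simp
    then have "(1 - cnj z * cis t) * (cis t - z) = cis t * of_real (n\<^sup>2)"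
      by (subst e) (metis mult.left_commute)
    moreover have "1 - cnj z * cis t \<noteq> 0" "cis t - z \<noteq> 0"
      using nz[of "cis t"] cis_ne_of_norm_less_1[OF z, of t] by auto
    ultimately have "cis t / ((1 - cnj z * cis t) * (cis t - z)) = 1 / of_real (n\<^sup>2)"
      using nn by (simp add: field_simps)
    then have "q (cis t) * c * (cis t / ((1 - cnj z * cis t) * (cis t - z))) = q (cis t) * (c / of_real (n\<^sup>2))"
      by simp
    then show "- \<i> * (F (cis t) / (cis t - z) * \<i> * cis t) = q (cis t) * of_real (poisson_kernel z (cis t))"
      by (simp add: F_def poisson_kernel_def n_def c_def field_simps)
  qed
qed

lemma continuous_poisson_kernel_cis:
  assumes "norm z < 1"
  shows "continuous_on UNIV (\<lambda>\<theta>. poisson_kernel z (cis \<theta>))"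
  unfolding poisson_kernel_def
  by (intro continuous_intros) (use cis_ne_of_norm_less_1[OF assms] in auto)

lemma borel_measurable_poisson_kernel_cis [measurable]:
  "norm z < 1 \<Longrightarrow> (\<lambda>\<theta>. poisson_kernel z (cis \<theta>)) \<in> borel_measurable borel"
  by (intro borel_measurable_continuous_onI continuous_poisson_kernel_cis)

lemma nn_integral_poisson_kernel:
  assumes z: "norm z < 1"
  shows "(\<integral>\<^sup>+\<theta>. ennreal (poisson_kernel z (cis \<theta>)) \<partial>circle_measure) = 1"
proof -
  have "((\<lambda>\<theta>. 1 * of_real (poisson_kernel z (cis \<theta>)) :: complex) has_integral of_real (2*pi) * 1) {0..2*pi}"
    by (rule poisson_formula[OF _ _ z]) auto
  from has_integral_Re[OF this]
  have "((\<lambda>\<theta>. poisson_kernel z (cis \<theta>)) has_integral 2*pi) {0..2*pi}" by simp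
  from nn_integral_circle_measure_has_integral[OF _ _ this] show ?thesis
    using z by (simp add: poisson_kernel_nonneg)
qed

lemma norm_le_poisson_integral:
  assumes cont: "continuous_on (cball 0 1) q" and hol: "q holomorphic_on ball 0 1"
    and z: "norm z < 1"
  shows "ennreal (norm (q z)) \<le> (\<integral>\<^sup>+\<theta>. ennreal (norm (q (cis \<theta>)) * poisson_kernel z (cis \<theta>)) \<partial>circle_measure)"
proof -
  define f where "f = (\<lambda>\<theta>. norm (q (cis \<theta>)) * poisson_kernel z (cis \<theta>))"
  have cf: "continuous_on UNIV f" unfolding f_def
    by (intro continuous_intros continuous_poisson_kernel_cis z
        continuous_on_compose2[OF cont]) auto
  have "f integrable_on {0..2*pi}"
    by (rule integrable_continuous_real) (rule continuous_on_subset[OF cf], auto)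
  then have I: "(f has_integral integral {0..2*pi} f) {0..2*pi}" by (rule integrable_integral)
  have nneg: "0 \<le> f \<theta>" for \<theta> using z by (auto simp: f_def poisson_kernel_nonneg)
  note Q = poisson_formula[OF cont hol z]
  have "norm (of_real (2*pi) * q z) \<le> integral {0..2*pi} f"
    unfolding integral_unique[OF Q, symmetric]
    by (rule integral_norm_bound_integral)
      (use Q I z in \<open>auto simp: f_def norm_mult poisson_kernel_nonneg has_integral_integrable\<close>)
  then have "norm (q z) \<le> integral {0..2*pi} f / (2*pi)"
    by (simp add: norm_mult field_simps)
  moreover have "(\<integral>\<^sup>+\<theta>. ennreal (f \<theta>) \<partial>circle_measure) = ennreal (integral {0..2*pi} f / (2*pi))"
    by (rule nn_integral_circle_measure_has_integral[OF _ nneg I])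
      (intro borel_measurable_continuous_onI cf)
  ultimately show ?thesis by (simp add: f_def ennreal_leI)
qed

section \<open>Subharmonicity of the square root of the modulus\<close>

text \<open>The quotient g / (w - a)^n is holomorphic off a, and near a it agrees with the regular
  factor \<open>zor_poly\<close>; these two open pieces cover S. Taking n to be the full order makes
  k a nonzero.\<close>

lemma factor_zero_holomorphic:
  assumes hol: "g holomorphic_on S" and S: "open S" "connected S" "a \<in> S" and nz: "w0 \<in> S" "g w0 \<noteq> 0"
  obtains n k where "k holomorphic_on S" "k a \<noteq> 0" "\<And>w. w \<in> S \<Longrightarrow> g w = (w - a) ^ n * k w"
proof -
  define n where "n = nat (zorder g a)"
  define p where "p = zor_poly g a"
  obtain r where r: "r > 0" "cball a r \<subseteq> S" "p holomorphic_on cball a r"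
    and eq: "\<And>w. w \<in> cball a r \<Longrightarrow> g w = p w * (w - a) ^ n \<and> p w \<noteq> 0"
    using zorder_exist_zero[OF hol S] nz unfolding n_def p_def by blast
  define k where "k = (\<lambda>w. if w = a then p a else g w / (w - a) ^ n)"
  have kp: "k w = p w" if "w \<in> cball a r" for w
    using eq[OF that] by (auto simp: k_def)
  have "k holomorphic_on S - {a}"
    by (rule holomorphic_transform[where f = "\<lambda>w. g w / (w - a) ^ n"])
      (auto simp: k_def intro!: holomorphic_intros holomorphic_on_subset[OF hol])
  moreover have "k holomorphic_on ball a r"
    by (rule holomorphic_transform[where f = p])
      (use kp r in \<open>auto intro: holomorphic_on_subset\<close>)
  ultimately have "k holomorphic_on (S - {a}) \<union> ball a r"
    by (intro holomorphic_on_Un) (auto intro: S open_Diff)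
  then have "k holomorphic_on S"
    by (rule holomorphic_on_subset) (use r in auto)
  moreover have "k a \<noteq> 0" using kp[of a] eq[of a] r by simp
  moreover have "g w = (w - a) ^ n * k w" if "w \<in> S" for w
    using eq[of a] r by (cases "w = a") (auto simp: k_def)
  ultimately show ?thesis by (rule that)
qed

text \<open>The difference of the squares is (1 - |a|^2) (1 - |w|^2).\<close>

lemma norm_moebius_le:
  assumes "norm (a::complex) < 1" "norm w \<le> 1"
  shows "norm (w - a) \<le> norm (1 - cnj a * w)"
proof -
  have "(norm (1 - cnj a * w))\<^sup>2 - (norm (w - a))\<^sup>2 = (1 - (norm a)\<^sup>2) * (1 - (norm w)\<^sup>2)"
    unfolding cmod_power2 by (simp add: power2_eq_square algebra_simps)
  moreover have "\<dots> \<ge> 0" using assms by (intro mult_nonneg_nonneg) (auto simp: power_le_one)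
  ultimately show ?thesis by (smt (verit) norm_ge_zero power2_le_imp_le)
qed

text \<open>Each zero \<open>a\<close> is exchanged for its reflection, \<open>w - a\<close> becoming \<open>1 - cnj a w\<close>; this amounts to dividing by a finite
  Blaschke product.\<close>

lemma blaschke_division:
  assumes "g holomorphic_on ball 0 R" "R > 1" "finite {z\<in>ball 0 1. g z = 0}"
  shows "\<exists>h. h holomorphic_on ball 0 R \<and> (\<forall>z\<in>ball 0 1. h z \<noteq> 0) \<and>
     (\<forall>z\<in>sphere 0 1. norm (h z) = norm (g z)) \<and> (\<forall>z\<in>cball 0 1. norm (g z) \<le> norm (h z))"
  using assms
\<comment> \<open>Induction on the number of distinct zeros in the open disc: each step reflects one
  zero with its full multiplicity.\<close>
proof (induction "card {z\<in>ball 0 1. g z = 0}" arbitrary: g)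
  case 0
  then have "{z\<in>ball 0 1. g z = 0} = {}" by (metis card_0_eq)
  then show ?case using 0 by (intro exI[of _ g]) auto
next
  case (Suc m)
  let ?Z = "{z\<in>ball 0 1. g z = 0}"
  have "?Z \<noteq> {}" using Suc(2) by (metis card.empty nat.distinct(1))
  then obtain a where a: "norm a < 1" "g a = 0" by auto
  \<comment> \<open>A finite zero set leaves a point of the disc where g is nonzero, as the
    factorization demands.\<close>
  have "infinite (ball (0::complex) 1)" using uncountable_ball[of 1 "0::complex"] countable_finite by auto
  then have "ball 0 1 - ?Z \<noteq> {}" using Suc.prems(3) Diff_infinite_finite finite.emptyI by metis
  then obtain w0 where "w0 \<in> ball 0 1 - ?Z" by blast
  then have w0: "norm w0 < 1" "g w0 \<noteq> 0" by auto
  have inR: "a \<in> ball 0 R" "w0 \<in> ball 0 R" using a w0 \<open>R > 1\<close> by auto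
  obtain n k where k: "k holomorphic_on ball 0 R" "k a \<noteq> 0"
    and gk: "\<And>w. w \<in> ball 0 R \<Longrightarrow> g w = (w - a) ^ n * k w"
    by (rule factor_zero_holomorphic[OF Suc.prems(1) open_ball connected_ball inR w0(2)]) (rule that)
  have n: "n > 0" using gk[of a] a k \<open>R > 1\<close> by (cases n) auto
  define g2 where "g2 = (\<lambda>w. (1 - cnj a * w) ^ n * k w)"
  note pos = one_minus_cnj_mult_nonzero[OF a(1)]
  \<comment> \<open>The new factor 1 - cnj a w has no zero in the closed unit disc, so exactly the
    zero a disappears.\<close>
  have Z2: "{z\<in>ball 0 1. g2 z = 0} = ?Z - {a}"
    using gk pos k n \<open>R > 1\<close> by (auto simp: g2_def)
  have g2h: "g2 holomorphic_on ball 0 R"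
    unfolding g2_def by (intro holomorphic_intros k)
  have "m = card {z\<in>ball 0 1. g2 z = 0}"
    unfolding Z2 using Suc(2) a Suc.prems(3) by (subst card_Diff_singleton) auto
  moreover have "finite {z\<in>ball 0 1. g2 z = 0}" unfolding Z2 using Suc.prems(3) by auto
  ultimately obtain h where h: "h holomorphic_on ball 0 R" "\<forall>z\<in>ball 0 1. h z \<noteq> 0"
     "\<forall>z\<in>sphere 0 1. norm (h z) = norm (g2 z)" "\<forall>z\<in>cball 0 1. norm (g2 z) \<le> norm (h z)"
    using Suc(1)[of g2] g2h \<open>R > 1\<close> by blast
  have le: "norm (g z) \<le> norm (g2 z)" if "norm z \<le> 1" for z
    using gk[of z] that \<open>R > 1\<close> norm_moebius_le[OF a(1) that]
    by (auto simp: g2_def norm_mult norm_power intro!: mult_right_mono power_mono)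
  have eq: "norm (g2 z) = norm (g z)" if "norm z = 1" for z
  proof -
    have "cis (Arg z) = z" using rcis_cmod_Arg[of z] that by (simp add: rcis_def)
    then have "norm (z - a) = norm (1 - cnj a * z)" using norm_cis_diff[of "Arg z" a] by simp
    then show ?thesis using gk[of z] that \<open>R > 1\<close> by (simp add: g2_def norm_mult norm_power)
  qed
  show ?case
    using h le eq by (intro exI[of _ h]) (auto intro: order_trans[OF le])
qed

text \<open>A function without zeros on the closed disc has none on a slightly larger disc. That
  disc is contractible, so h = q^2 there, and |h|^(1/2) = |q| obeys the Poisson inequality for
  holomorphic functions.\<close>

lemma sqrt_norm_le_poisson_nonvanishing:
  assumes h: "h holomorphic_on ball 0 R" and R: "R > 1" and nz: "\<And>z. z \<in> cball 0 1 \<Longrightarrow> h z \<noteq> 0"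
    and z: "norm z < 1"
  shows "ennreal (sqrt (norm (h z))) \<le>
    (\<integral>\<^sup>+\<theta>. ennreal (sqrt (norm (h (cis \<theta>))) * poisson_kernel z (cis \<theta>)) \<partial>circle_measure)"
proof -
  define U where "U = {w\<in>ball 0 R. h w \<noteq> 0}"
  have "open (ball 0 R \<inter> h -` (- {0}))"
    by (intro continuous_open_preimage holomorphic_on_imp_continuous_on[OF h]) auto
  moreover have "U = ball 0 R \<inter> h -` (- {0})" by (auto simp: U_def)
  ultimately have "open U" by simp
  moreover have "cball 0 1 \<subseteq> U" using nz R by (auto simp: U_def)
  ultimately obtain \<epsilon> where e: "\<epsilon> > 0" "(\<Union>x\<in>cball 0 1. ball x \<epsilon>) \<subseteq> U"
    using compact_subset_open_imp_ball_epsilon_subset[OF compact_cball] by metis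
  \<comment> \<open>A point of norm below 1 + \<epsilon> either lies in the closed disc or is within
    \<epsilon> of its radial projection \<open>sgn w\<close>.\<close>
  have sub: "ball 0 (1 + \<epsilon>) \<subseteq> U"
  proof
    fix w :: complex assume w: "w \<in> ball 0 (1 + \<epsilon>)"
    have "\<exists>x\<in>cball 0 1. w \<in> ball x \<epsilon>"
    proof (cases "norm w \<le> 1")
      case False
      then have "w \<noteq> 0" by auto
      then have eqw: "w - sgn w = of_real (norm w - 1) * sgn w"
        by (simp add: sgn_eq field_simps)
      have "norm (w - sgn w) = norm w - 1"
        unfolding eqw norm_mult norm_of_real using False by (auto simp: norm_sgn)
      then show ?thesis using w False
        by (intro bexI[of _ "sgn w"]) (auto simp: dist_norm norm_minus_commute norm_sgn)
    next
      case True
      then show ?thesis using e by (intro bexI[of _ w]) auto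
    qed
    then show "w \<in> U" using e by blast
  qed
  have "h holomorphic_on ball 0 (1 + \<epsilon>)"
    by (rule holomorphic_on_subset[OF h]) (use sub in \<open>auto simp: U_def\<close>)
  then obtain q where q: "q holomorphic_on ball 0 (1 + \<epsilon>)" "\<And>w. w \<in> ball 0 (1 + \<epsilon>) \<Longrightarrow> h w = (q w)\<^sup>2"
    by (rule contractible_imp_holomorphic_sqrt[of h "ball 0 (1 + \<epsilon>)"])
      (use sub in \<open>auto simp: U_def convex_imp_contractible\<close>)
  have sq: "sqrt (norm (h w)) = norm (q w)" if "norm w \<le> 1" for w
    using q(2)[of w] that e by (simp add: norm_power)
  have "ennreal (norm (q z)) \<le> (\<integral>\<^sup>+\<theta>. ennreal (norm (q (cis \<theta>)) * poisson_kernel z (cis \<theta>)) \<partial>circle_measure)"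
    by (intro norm_le_poisson_integral z holomorphic_on_imp_continuous_on holomorphic_on_subset[OF q(1)])
      (use e in auto)
  then show ?thesis using sq[of z] z by (simp add: sq)
qed

text \<open>Reflection cannot move a zero on the circle, so such zeros are excluded unless g is
  constant, where both sides agree because the kernel has mean 1. Otherwise the zeros inside are
  finitely many, and replacing g by h keeps the boundary modulus without lowering the modulus
  inside.\<close>

lemma sqrt_norm_le_poisson:
  assumes g: "g holomorphic_on ball 0 R" and R: "R > 1"
    and *: "g constant_on ball 0 R \<or> (\<forall>z\<in>sphere 0 1. g z \<noteq> 0)"
    and z: "norm z < 1"
  shows "ennreal (sqrt (norm (g z))) \<le>
    (\<integral>\<^sup>+\<theta>. ennreal (sqrt (norm (g (cis \<theta>))) * poisson_kernel z (cis \<theta>)) \<partial>circle_measure)"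
proof (cases "\<forall>z\<in>sphere 0 1. g z \<noteq> 0")
  case True
  have "\<exists>h. h holomorphic_on ball 0 R \<and> (\<forall>z\<in>ball 0 1. h z \<noteq> 0) \<and>
     (\<forall>z\<in>sphere 0 1. norm (h z) = norm (g z)) \<and> (\<forall>z\<in>cball 0 1. norm (g z) \<le> norm (h z))"
  proof (cases "g constant_on ball 0 R")
    case c: True
    then obtain c where c: "\<And>w. w \<in> ball 0 R \<Longrightarrow> g w = c" by (auto simp: constant_on_def)
    have "c \<noteq> 0" using True c[of 1] R by auto
    then show ?thesis using g c R by (intro exI[of _ g]) auto
  next
    case False
    then have "finite {z\<in>cball 0 1. g z = 0}"
      by (intro holomorphic_compact_finite_zeros[OF g]) (use R in auto)
    then have "finite {z\<in>ball 0 1. g z = 0}"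
      by (rule finite_subset[rotated]) auto
    then show ?thesis by (rule blaschke_division[OF g R])
  qed
  then obtain h where h: "h holomorphic_on ball 0 R" "\<forall>z\<in>ball 0 1. h z \<noteq> 0"
     "\<forall>z\<in>sphere 0 1. norm (h z) = norm (g z)" "\<forall>z\<in>cball 0 1. norm (g z) \<le> norm (h z)" by blast
  have nz: "h w \<noteq> 0" if "w \<in> cball 0 1" for w
  proof (cases "norm w = 1")
    case n: True
    then have "norm (h w) = norm (g w)" "g w \<noteq> 0" using h(3) True by auto
    then show ?thesis by auto
  qed (use h(2) that in auto)
  have "sqrt (norm (g z)) \<le> sqrt (norm (h z))" using h(4) z by auto
  then have "ennreal (sqrt (norm (g z))) \<le> ennreal (sqrt (norm (h z)))" by (rule ennreal_leI)
  also have "\<dots> \<le> (\<integral>\<^sup>+\<theta>. ennreal (sqrt (norm (h (cis \<theta>))) * poisson_kernel z (cis \<theta>)) \<partial>circle_measure)"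
    by (rule sqrt_norm_le_poisson_nonvanishing[OF h(1) R nz z])
  finally show ?thesis using h(3) by simp
next
  case False
  then obtain c where c: "\<And>w. w \<in> ball 0 R \<Longrightarrow> g w = c" using * by (auto simp: constant_on_def)
  have "(\<integral>\<^sup>+\<theta>. ennreal (sqrt (norm (g (cis \<theta>))) * poisson_kernel z (cis \<theta>)) \<partial>circle_measure)
      = ennreal (sqrt (norm c)) * (\<integral>\<^sup>+\<theta>. ennreal (poisson_kernel z (cis \<theta>)) \<partial>circle_measure)"
    using c R z by (subst nn_integral_cmult[symmetric])
      (auto simp: ennreal_mult poisson_kernel_nonneg
        intro!: nn_integral_cong measurable_circle_measureI measurable_compose[OF _ measurable_ennreal])
  then show ?thesis using c[of z] z R by (simp add: nn_integral_poisson_kernel)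
qed


section \<open>Level sets and arcs\<close>

text \<open>Chordal distance is used instead of the angle: \<open>cis\<close> then maps the set into
  the closed ball of centre \<xi> and radius h, so disjoint balls give disjoint arcs.\<close>

definition arc_set :: "complex \<Rightarrow> real \<Rightarrow> real set" where
  "arc_set \<xi> h = {\<theta>. norm (cis \<theta> - \<xi>) \<le> h}"

lemma arc_set_borel [measurable]: "arc_set \<xi> h \<in> sets borel"
proof -
  have "closed (arc_set \<xi> h)" unfolding arc_set_def
    by (intro closed_Collect_le continuous_intros)
  then show ?thesis by simp
qed

text \<open>With \<delta> = 1 - r the kernel is at most 2 \<delta> / |cis \<theta> - z|^2. It is of
  size 1 / \<delta> near \<xi> and drops by a factor 4 whenever the chordal distance to \<xi>
  doubles.\<close>

lemma poisson_kernel_dyadic_bound: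
  assumes r: "0 \<le> r" "r < 1" and \<xi>: "norm \<xi> = 1"
  shows "ennreal (poisson_kernel (of_real r * \<xi>) (cis \<theta>)) \<le>
    ennreal (32 / (1 - r)) * (\<Sum>k. ennreal ((1/4)^k) * indicator (arc_set \<xi> (2^k * (1 - r))) \<theta>)"
proof -
  define z where "z = of_real r * \<xi>"
  define \<delta> where "\<delta> = 1 - r"
  define d where "d = norm (cis \<theta> - \<xi>)"
  define n where "n = norm (cis \<theta> - z)"
  have d: "\<delta> > 0" "\<delta> \<le> 1" using r by (auto simp: \<delta>_def)
  have nz: "norm z = r" using r \<xi> by (simp add: z_def norm_mult)
  have n1: "\<delta> \<le> n"
    using norm_triangle_ineq2[of "cis \<theta>" z] by (simp add: n_def \<delta>_def nz)
  have zx: "norm (z - \<xi>) = \<delta>"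
  proof -
    have "z - \<xi> = of_real (r - 1) * \<xi>" by (simp add: z_def algebra_simps)
    then show ?thesis unfolding \<delta>_def by (simp only: norm_mult norm_of_real) (use r \<xi> in auto)
  qed
  have "d \<le> n + \<delta>"
    using norm_triangle_ineq[of "cis \<theta> - z" "z - \<xi>"] by (simp add: d_def n_def zx)
  then have n2: "d \<le> 2 * n" using n1 by simp
  have P: "poisson_kernel z (cis \<theta>) \<le> 2 * \<delta> / n\<^sup>2"
  proof -
    have "1 - r\<^sup>2 \<le> 2 * \<delta>"
      using zero_le_power2[of "1 - r"] by (simp add: \<delta>_def power2_eq_square algebra_simps)
    then show ?thesis unfolding poisson_kernel_def nz n_def by (intro divide_right_mono) auto
  qed
  obtain k0 where k0: "d / \<delta> < 2 ^ k0" using real_arch_pow[of 2 "d / \<delta>"] by auto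
  \<comment> \<open>The first dyadic dilate of the arc that contains the point; its single term of
    the series already dominates the kernel.\<close>
  define k where "k = (LEAST k. d \<le> 2 ^ k * \<delta>)"
  have ex: "d \<le> 2 ^ k0 * \<delta>" using k0 d by (simp add: field_simps)
  have k: "d \<le> 2 ^ k * \<delta>" unfolding k_def by (rule LeastI[of _ k0]) (rule ex)
  have main: "2 * \<delta> / n\<^sup>2 \<le> 32 / \<delta> * (1/4)^k"
  proof (cases k)
    case 0
    have "\<delta>\<^sup>2 \<le> n\<^sup>2" using n1 d by (intro power_mono) auto
    then have "2 * \<delta> / n\<^sup>2 \<le> 2 * \<delta> / \<delta>\<^sup>2" using d by (intro divide_left_mono) (auto intro!: mult_pos_pos simp: less_le_trans[OF _ \<open>\<delta>\<^sup>2 \<le> n\<^sup>2\<close>])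
    also have "\<dots> \<le> 32 / \<delta>" using d by (simp add: power2_eq_square field_simps)
    finally show ?thesis using 0 by simp
  next
    case (Suc j)
    \<comment> \<open>Minimality puts the point outside the previous arc, which bounds its distance
      to z from below.\<close>
    have "\<not> d \<le> 2 ^ j * \<delta>" using not_less_Least[of j "\<lambda>k. d \<le> 2 ^ k * \<delta>"] Suc by (auto simp: k_def)
    then have "2 ^ j * \<delta> \<le> 2 * n" using n2 by simp
    then have "(2 ^ j * \<delta>)\<^sup>2 \<le> (2 * n)\<^sup>2" using d by (intro power_mono) auto
    then have nn: "(2 ^ j * \<delta>)\<^sup>2 / 4 \<le> n\<^sup>2" by (simp add: power_mult_distrib)
    have p: "(2 ^ j * \<delta>)\<^sup>2 / 4 > 0" using d by simp
    then have "2 * \<delta> / n\<^sup>2 \<le> 2 * \<delta> / ((2 ^ j * \<delta>)\<^sup>2 / 4)"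
      using d nn by (intro divide_left_mono) (auto intro!: mult_pos_pos simp: less_le_trans[OF p nn])
    also have "\<dots> = 8 / \<delta> * (1/4)^j"
      using d by (simp add: power_mult_distrib power2_eq_square field_simps flip: power_mult)
        (simp add: power_mult_distrib[symmetric])
    also have "\<dots> = 32 / \<delta> * (1/4)^k" by (simp add: Suc)
    finally show ?thesis .
  qed
  have "ennreal (poisson_kernel z (cis \<theta>)) \<le> ennreal (32 / \<delta> * (1/4)^k)"
    using P main by (intro ennreal_leI) simp
  also have "\<dots> = ennreal (32 / \<delta>) * (ennreal ((1/4)^k) * indicator (arc_set \<xi> (2^k * \<delta>)) \<theta>)"
    using k d by (subst ennreal_mult) (auto simp: arc_set_def d_def)
  also have "\<dots> \<le> ennreal (32 / \<delta>) * (\<Sum>k. ennreal ((1/4)^k) * indicator (arc_set \<xi> (2^k * \<delta>)) \<theta>)"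
  proof (rule mult_left_mono)
    have "f k \<le> suminf f" for f :: "nat \<Rightarrow> ennreal"
      using sum_le_suminf[OF summableI, of "{k}" f] by simp
    then show "ennreal ((1/4)^k) * indicator (arc_set \<xi> (2^k * \<delta>)) \<theta>
        \<le> (\<Sum>k. ennreal ((1/4)^k) * indicator (arc_set \<xi> (2^k * \<delta>)) \<theta>)" .
  qed simp
  finally show ?thesis by (simp add: z_def \<delta>_def)
qed

text \<open>If the Poisson integral of \<open>w\<close> at \<open>r \<xi>\<close> is large, so is a mean of \<open>w\<close> over an arc around \<open>\<xi>\<close> that is not
  shorter than the distance of the point to the circle: a pointwise form of the domination of
  the Poisson integral by the Hardy--Littlewood maximal function.\<close>

lemma poisson_integral_large_imp_arc:
  fixes w :: "real \<Rightarrow> ennreal"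
  assumes [measurable]: "w \<in> borel_measurable borel"
    and r: "0 \<le> r" "r < 1" and \<xi>: "norm \<xi> = 1" and l: "0 \<le> l"
    and big: "ennreal l < (\<integral>\<^sup>+\<theta>. w \<theta> * ennreal (poisson_kernel (of_real r * \<xi>) (cis \<theta>)) \<partial>circle_measure)"
  shows "\<exists>h\<ge>1 - r. ennreal (l * h / 64) < (\<integral>\<^sup>+\<theta>. w \<theta> * indicator (arc_set \<xi> h) \<theta> \<partial>circle_measure)"
proof (rule ccontr)
  define \<delta> where "\<delta> = 1 - r"
  have d: "\<delta> > 0" using r by (simp add: \<delta>_def)
  assume "\<not> ?thesis"
  then have small: "(\<integral>\<^sup>+\<theta>. w \<theta> * indicator (arc_set \<xi> h) \<theta> \<partial>circle_measure) \<le> ennreal (l * h / 64)"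
    if "\<delta> \<le> h" for h using that by (auto simp: not_less \<delta>_def)
  have scale: "ennreal (32 / \<delta> * (1/4)^k) = ennreal (32 / \<delta>) * ennreal ((1/4)^k)" for k
    using d by (intro ennreal_mult) auto
  have [measurable]: "(\<lambda>\<theta>. w \<theta> * indicator (arc_set \<xi> h) \<theta>) \<in> borel_measurable circle_measure" for h
    by (intro measurable_circle_measureI) measurable
  have "(\<integral>\<^sup>+\<theta>. w \<theta> * ennreal (poisson_kernel (of_real r * \<xi>) (cis \<theta>)) \<partial>circle_measure)
    \<le> (\<integral>\<^sup>+\<theta>. w \<theta> * (ennreal (32 / \<delta>) * (\<Sum>k. ennreal ((1/4)^k) * indicator (arc_set \<xi> (2^k * \<delta>)) \<theta>)) \<partial>circle_measure)"
    unfolding \<delta>_def by (intro nn_integral_mono mult_left_mono poisson_kernel_dyadic_bound r \<xi>) auto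
  also have "\<dots> = (\<integral>\<^sup>+\<theta>. (\<Sum>k. ennreal (32 / \<delta> * (1/4)^k) * (w \<theta> * indicator (arc_set \<xi> (2^k * \<delta>)) \<theta>)) \<partial>circle_measure)"
    by (intro nn_integral_cong)
      (simp only: scale ennreal_suminf_cmult[symmetric], simp only: ac_simps)
  also have "\<dots> = (\<Sum>k. ennreal (32 / \<delta> * (1/4)^k) * (\<integral>\<^sup>+\<theta>. w \<theta> * indicator (arc_set \<xi> (2^k * \<delta>)) \<theta> \<partial>circle_measure))"
    by (subst nn_integral_suminf) (simp_all add: nn_integral_cmult)
  \<comment> \<open>If every admissible arc had small mass, the terms would form a geometric series
    of ratio 1/2. The constant 64 = 2 * 32 makes its sum exactly l.\<close>
  also have "\<dots> \<le> (\<Sum>k. ennreal (32 / \<delta> * (1/4)^k) * ennreal (l * (2^k * \<delta>) / 64))"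
    using d by (intro suminf_le mult_left_mono small summableI) auto
  also have "\<dots> = (\<Sum>k. ennreal (l / 2 * (1/2)^k))"
  proof (intro suminf_cong)
    fix k
    have "32 / \<delta> * (1/4)^k * (l * (2^k * \<delta>) / 64) = l / 2 * ((1/4)^k * 2^k)"
      using d by (simp add: field_simps)
    also have "\<dots> = l / 2 * (1/2)^k" by (simp flip: power_mult_distrib)
    finally show "ennreal (32 / \<delta> * (1/4)^k) * ennreal (l * (2^k * \<delta>) / 64) = ennreal (l / 2 * (1/2)^k)"
      using d l by (subst ennreal_mult[symmetric]) auto
  qed
  also have "\<dots> = ennreal l"
  proof (rule suminf_ennreal_eq)
    show "(\<lambda>k. l / 2 * (1/2)^k) sums l"
      using sums_mult[OF geometric_sums[of "1/2::real"], of "l/2"] by simp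
  qed (use l in auto)
  finally show False using big by simp
qed

text \<open>Subadditivity on the left meets countable additivity over the disjoint sets on the
  right. The index set is spread over the naturals, each n carrying at most one index.\<close>

lemma emeasure_UN_le_disjoint:
  assumes C: "countable C" and X: "\<And>c. c \<in> C \<Longrightarrow> X c \<in> sets M" and Y: "\<And>c. c \<in> C \<Longrightarrow> Y c \<in> sets N"
    and disj: "disjoint_family_on Y C"
    and le: "\<And>c. c \<in> C \<Longrightarrow> emeasure M (X c) \<le> k * emeasure N (Y c)"
  shows "emeasure M (\<Union>c\<in>C. X c) \<le> k * emeasure N (space N)"
proof -
  define D where "D n = {c\<in>C. to_nat_on C c = n}" for n
  define A where "A n = (\<Union>c\<in>D n. X c)" for n
  define B where "B n = (\<Union>c\<in>D n. Y c)" for n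
  have D: "D n = {} \<or> (\<exists>c\<in>C. D n = {c})" for n
    using inj_on_to_nat_on[OF C] unfolding D_def inj_on_def by blast
  have A: "A n \<in> sets M" and B: "B n \<in> sets N" and AB: "emeasure M (A n) \<le> k * emeasure N (B n)" for n
    using D[of n] X Y le by (auto simp: A_def B_def)
  have "disjoint_family B"
    unfolding disjoint_family_on_def
  proof (intro ballI impI)
    fix m n :: nat assume "m \<noteq> n"
    show "B m \<inter> B n = {}"
    proof (rule ccontr)
      assume "B m \<inter> B n \<noteq> {}"
      then obtain x c c' where x: "c \<in> D m" "x \<in> Y c" "c' \<in> D n" "x \<in> Y c'" by (auto simp: B_def)
      then have "c \<noteq> c'" "c \<in> C" "c' \<in> C" using \<open>m \<noteq> n\<close> by (auto simp: D_def)
      then show False using disj x unfolding disjoint_family_on_def by blast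
    qed
  qed
  have "(\<Union>c\<in>C. X c) = (\<Union>n. A n)" by (auto simp: A_def D_def)
  then have "emeasure M (\<Union>c\<in>C. X c) \<le> (\<Sum>n. emeasure M (A n))"
    using emeasure_subadditive_countably[of A M] A by auto
  also have "\<dots> \<le> (\<Sum>n. k * emeasure N (B n))" by (intro suminf_le AB summableI)
  also have "\<dots> = k * (\<Sum>n. emeasure N (B n))" by simp
  also have "(\<Sum>n. emeasure N (B n)) = emeasure N (\<Union>n. B n)"
    by (rule suminf_emeasure) (use B \<open>disjoint_family B\<close> in auto)
  also have "k * emeasure N (\<Union>n. B n) \<le> k * emeasure N (space N)"
    by (intro mult_left_mono emeasure_space) auto
  finally show ?thesis .
qed


section \<open>Truncated square roots and the weak-type estimate\<close>

definition trunc_sqrt :: "(complex \<Rightarrow> complex) \<Rightarrow> real \<Rightarrow> real \<Rightarrow> ennreal" where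
  "trunc_sqrt g \<tau> \<theta> = ennreal (sqrt (norm (g (cis \<theta>)))) * indicator {\<theta>. \<tau> < norm (g (cis \<theta>))} \<theta>"

lemma continuous_on_cis_compose:
  "continuous_on (cball 0 1) g \<Longrightarrow> continuous_on UNIV (\<lambda>\<theta>. g (cis \<theta>))"
  by (rule continuous_on_compose2[where t = "cball 0 1"]) (auto intro!: continuous_intros)

lemma borel_measurable_cis_compose:
  fixes g :: "complex \<Rightarrow> complex"
  assumes "continuous_on (cball 0 1) g"
  shows "(\<lambda>\<theta>. g (cis \<theta>)) \<in> borel_measurable borel"
  by (intro borel_measurable_continuous_onI continuous_on_cis_compose assms)

lemma borel_measurable_trunc_sqrt:
  assumes "continuous_on (cball 0 1) g"
  shows "trunc_sqrt g \<tau> \<in> borel_measurable borel"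
proof -
  note [measurable] = borel_measurable_cis_compose[OF assms]
  show ?thesis unfolding trunc_sqrt_def[abs_def] by measurable
qed

text \<open>Cutting \<open>sqrt |g|\<close> at height \<open>sqrt \<tau>\<close> costs the Poisson integral at most \<open>sqrt \<tau>\<close>, half of its value.\<close>

lemma level_set_imp_arc:
  assumes cont: "continuous_on (cball 0 1) g"
    and sub: "\<And>z. norm z < 1 \<Longrightarrow> ennreal (sqrt (norm (g z))) \<le>
      (\<integral>\<^sup>+\<theta>. ennreal (sqrt (norm (g (cis \<theta>))) * poisson_kernel z (cis \<theta>)) \<partial>circle_measure)"
    and tau: "0 \<le> \<tau>" and z: "norm z \<le> 1" "4 * \<tau> < norm (g z)"
  shows "\<exists>\<xi> h. norm \<xi> = 1 \<and> 0 < h \<and> norm (z - \<xi>) \<le> h \<and>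
    ennreal (sqrt \<tau> * h / 64) < (\<integral>\<^sup>+\<theta>. trunc_sqrt g \<tau> \<theta> * indicator (arc_set \<xi> h) \<theta> \<partial>circle_measure)"
proof -
  note [measurable] = borel_measurable_trunc_sqrt[OF cont, of \<tau>]
  \<comment> \<open>Interior points come first; boundary points are reduced to them below.\<close>
  have inner: "\<exists>h\<ge>1 - r. ennreal (sqrt \<tau> * h / 64) <
      (\<integral>\<^sup>+\<theta>. trunc_sqrt g \<tau> \<theta> * indicator (arc_set \<xi> h) \<theta> \<partial>circle_measure)"
    if r: "0 \<le> r" "r < 1" and x: "norm \<xi> = 1" and big: "4 * \<tau> < norm (g (of_real r * \<xi>))" for r \<xi>
  proof (rule poisson_integral_large_imp_arc[OF _ r x])
    define z where "z = of_real r * \<xi>"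
    define P where "P = (\<lambda>\<theta>. ennreal (poisson_kernel z (cis \<theta>)))"
    have nz: "norm z < 1" using r x by (simp add: z_def norm_mult)
    have [measurable]: "P \<in> borel_measurable borel" unfolding P_def
      using borel_measurable_poisson_kernel_cis[OF nz] by measurable
    have le: "ennreal (sqrt (norm (g (cis \<theta>))) * poisson_kernel z (cis \<theta>)) \<le>
        trunc_sqrt g \<tau> \<theta> * P \<theta> + ennreal (sqrt \<tau>) * P \<theta>" for \<theta>
    proof -
      have "ennreal (sqrt (norm (g (cis \<theta>)))) \<le> trunc_sqrt g \<tau> \<theta> + ennreal (sqrt \<tau>)"
        using tau by (auto simp: trunc_sqrt_def indicator_def intro!: ennreal_leI)
      then have "ennreal (sqrt (norm (g (cis \<theta>)))) * P \<theta> \<le> (trunc_sqrt g \<tau> \<theta> + ennreal (sqrt \<tau>)) * P \<theta>"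
        by (rule mult_right_mono) simp
      then show ?thesis using nz
        by (simp add: P_def ennreal_mult poisson_kernel_nonneg distrib_right)
    qed
    have "ennreal (2 * sqrt \<tau>) < ennreal (sqrt (norm (g z)))"
    proof (rule ennreal_lessI)
      have "sqrt (4 * \<tau>) < sqrt (norm (g z))" using big by (simp add: z_def)
      then show "2 * sqrt \<tau> < sqrt (norm (g z))" by (simp add: real_sqrt_mult)
    qed (use tau big in \<open>auto simp: z_def\<close>)
    also have "\<dots> \<le> (\<integral>\<^sup>+\<theta>. trunc_sqrt g \<tau> \<theta> * P \<theta> + ennreal (sqrt \<tau>) * P \<theta> \<partial>circle_measure)"
      by (rule order_trans[OF sub[OF nz]]) (intro nn_integral_mono le)
    also have "\<dots> = (\<integral>\<^sup>+\<theta>. trunc_sqrt g \<tau> \<theta> * P \<theta> \<partial>circle_measure) + ennreal (sqrt \<tau>)"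
      using nn_integral_poisson_kernel[OF nz]
      by (subst nn_integral_add) (auto intro!: measurable_circle_measureI
        simp: nn_integral_cmult[OF measurable_circle_measureI] P_def[symmetric])
    finally have *: "ennreal (2 * sqrt \<tau>) < (\<integral>\<^sup>+\<theta>. trunc_sqrt g \<tau> \<theta> * P \<theta> \<partial>circle_measure) + ennreal (sqrt \<tau>)" .
    show "ennreal (sqrt \<tau>) < (\<integral>\<^sup>+\<theta>. trunc_sqrt g \<tau> \<theta> * ennreal (poisson_kernel (of_real r * \<xi>) (cis \<theta>)) \<partial>circle_measure)"
    proof (rule ccontr)
      assume "\<not> ?thesis"
      then have "(\<integral>\<^sup>+\<theta>. trunc_sqrt g \<tau> \<theta> * P \<theta> \<partial>circle_measure) + ennreal (sqrt \<tau>) \<le> ennreal (sqrt \<tau>) + ennreal (sqrt \<tau>)"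
        by (intro add_right_mono) (simp add: P_def z_def not_less)
      also have "\<dots> = ennreal (2 * sqrt \<tau>)" using tau by (simp flip: ennreal_plus)
      finally show False using * by simp
    qed
  qed (use tau in auto)
  \<comment> \<open>Radial projection of z; at the origin any point of the circle serves.\<close>
  define \<xi> where "\<xi> = (if z = 0 then 1 else sgn z)"
  have x: "norm \<xi> = 1" by (simp add: \<xi>_def norm_sgn)
  have zx: "z = of_real (norm z) * \<xi>" by (simp add: \<xi>_def sgn_eq)
  have dist: "norm (z - \<xi>) = 1 - norm z"
  proof -
    have "z - \<xi> = of_real (norm z - 1) * \<xi>" by (subst zx) (simp add: algebra_simps)
    then show ?thesis using x z by (simp only: norm_mult norm_of_real) auto
  qed
  show ?thesis
  proof (cases "norm z < 1")
    case True
    from inner[of "norm z" \<xi>] obtain h where "h \<ge> 1 - norm z"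
      "ennreal (sqrt \<tau> * h / 64) < (\<integral>\<^sup>+\<theta>. trunc_sqrt g \<tau> \<theta> * indicator (arc_set \<xi> h) \<theta> \<partial>circle_measure)"
      using True x z zx by auto
    then show ?thesis using x dist True by (intro exI[of _ \<xi>] exI[of _ h]) auto
  next
    case False
    then have nz: "norm z = 1" using z by simp
    then have "\<xi> = z" using zx by simp
    \<comment> \<open>At a boundary point the strict inequality persists at r \<xi> for some r < 1;
      the arc found there has positive length and serves for z as well.\<close>
    have "continuous_on {0..1} (\<lambda>r. norm (g (of_real r * \<xi>)))"
      by (intro continuous_intros continuous_on_compose2[OF cont]) (auto simp: norm_mult x)
    then have "((\<lambda>r. norm (g (of_real r * \<xi>))) \<longlongrightarrow> norm (g (of_real 1 * \<xi>))) (at 1 within {0..1})"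
      unfolding continuous_on_def by (rule bspec) simp
    then have "\<forall>\<^sub>F r in at 1 within {0..1}. 4 * \<tau> < norm (g (of_real r * \<xi>))"
      by (rule order_tendstoD) (use z \<open>\<xi> = z\<close> in simp)
    moreover have "at (1::real) within {0..1} = at_left 1"
      by (rule at_within_Icc_at_left) simp
    ultimately have "\<forall>\<^sub>F r in at_left 1. 4 * \<tau> < norm (g (of_real r * \<xi>))" by simp
    moreover have "\<forall>\<^sub>F r in at_left (1::real). r \<in> {0<..<1}" by (rule eventually_at_leftI[of 0]) auto
    ultimately have "\<forall>\<^sub>F r in at_left 1. 4 * \<tau> < norm (g (of_real r * \<xi>)) \<and> r \<in> {0<..<1}"
      by eventually_elim auto
    then have "\<exists>r. 4 * \<tau> < norm (g (of_real r * \<xi>)) \<and> r \<in> {0<..<1}"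
      by (rule eventually_happens'[OF trivial_limit_at_left_real])
    then obtain r where r: "4 * \<tau> < norm (g (of_real r * \<xi>))" "0 < r" "r < 1" by auto
    from inner[of r \<xi>] r x obtain h where "h \<ge> 1 - r"
      "ennreal (sqrt \<tau> * h / 64) < (\<integral>\<^sup>+\<theta>. trunc_sqrt g \<tau> \<theta> * indicator (arc_set \<xi> h) \<theta> \<partial>circle_measure)"
      by auto
    then show ?thesis using x dist r nz by (intro exI[of _ \<xi>] exI[of _ h]) auto
  qed
qed

text \<open>The balls of Vitali's lemma are centred on the circle and contain the points of the level set themselves, not
  just their radial projections; hence enlarging them fivefold covers the level set by windows of comparable size.\<close>

lemma weak_type_estimate:
  assumes sets: "sets \<mu> = sets (restrict_space borel (cball (0::complex) 1))"
    and cont: "continuous_on (cball 0 1) g"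
    and sub: "\<And>z. norm z < 1 \<Longrightarrow> ennreal (sqrt (norm (g z))) \<le>
      (\<integral>\<^sup>+\<theta>. ennreal (sqrt (norm (g (cis \<theta>))) * poisson_kernel z (cis \<theta>)) \<partial>circle_measure)"
    and tau: "0 < \<tau>" and K: "0 \<le> K"
    and win: "\<And>\<xi> h. norm \<xi> = 1 \<Longrightarrow> 0 < h \<Longrightarrow> 16 * h \<le> H \<Longrightarrow>
      emeasure \<mu> (cball \<xi> (5 * h) \<inter> cball 0 1) \<le> ennreal (16 * h * K)"
    and tot: "(\<integral>\<^sup>+\<theta>. trunc_sqrt g \<tau> \<theta> \<partial>circle_measure) \<le> ennreal (sqrt \<tau> * H / 1024)" and H: "H \<ge> 0"
  shows "emeasure \<mu> {z\<in>cball 0 1. 4 * \<tau> < norm (g z)} \<le>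
    ennreal (1024 * K / sqrt \<tau>) * (\<integral>\<^sup>+\<theta>. trunc_sqrt g \<tau> \<theta> \<partial>circle_measure)"
proof -
  note [measurable] = borel_measurable_trunc_sqrt[OF cont, of \<tau>]
  define E where "E = {z\<in>cball 0 1. 4 * \<tau> < norm (g z)}"
  define N where "N = density circle_measure (trunc_sqrt g \<tau>)"
  define Q where "Q = {c::complex\<times>real. norm (fst c) = 1 \<and> 0 < snd c \<and>
    ennreal (sqrt \<tau> * snd c / 64) < (\<integral>\<^sup>+\<theta>. trunc_sqrt g \<tau> \<theta> * indicator (arc_set (fst c) (snd c)) \<theta> \<partial>circle_measure)}"
  \<comment> \<open>An arc whose mass is proportional to its length cannot be long when the total
    mass is small: 1024 = 16 * 64. This also bounds the radii, as Vitali's lemma requires.\<close>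
  have bound: "16 * snd c \<le> H" if "c \<in> Q" for c
  proof -
    have "ennreal (sqrt \<tau> * snd c / 64) < (\<integral>\<^sup>+\<theta>. trunc_sqrt g \<tau> \<theta> * indicator (arc_set (fst c) (snd c)) \<theta> \<partial>circle_measure)"
      using that by (simp add: Q_def)
    also have "\<dots> \<le> (\<integral>\<^sup>+\<theta>. trunc_sqrt g \<tau> \<theta> \<partial>circle_measure)"
      by (intro nn_integral_mono) (auto simp: indicator_def)
    also note tot
    finally have "sqrt \<tau> * snd c / 64 < sqrt \<tau> * H / 1024"
      using that tau by (subst (asm) ennreal_less_iff) (auto simp: Q_def)
    then have "sqrt \<tau> * (16 * snd c) < sqrt \<tau> * H" by simp
    then show ?thesis using tau by simp
  qed
  have cover: "E \<subseteq> (\<Union>c\<in>Q. cball (fst c) (snd c))"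
  proof
    fix z assume "z \<in> E"
    then obtain \<xi> h where "norm \<xi> = 1 \<and> 0 < h \<and> norm (z - \<xi>) \<le> h \<and>
        ennreal (sqrt \<tau> * h / 64) < (\<integral>\<^sup>+\<theta>. trunc_sqrt g \<tau> \<theta> * indicator (arc_set \<xi> h) \<theta> \<partial>circle_measure)"
      using level_set_imp_arc[OF cont sub, of \<tau> z] tau by (auto simp: E_def)
    then show "z \<in> (\<Union>c\<in>Q. cball (fst c) (snd c))"
      by (intro UN_I[of "(\<xi>, h)"]) (auto simp: Q_def dist_norm norm_minus_commute)
  qed
  have rad: "0 < snd c \<and> snd c \<le> H / 16" if "c \<in> Q" for c
    using bound[OF that] that by (auto simp: Q_def)
  obtain C where C: "countable C" "C \<subseteq> Q"
    and disj: "pairwise (\<lambda>i j. disjnt (cball (fst i) (snd i)) (cball (fst j) (snd j))) C"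
    and cov: "E \<subseteq> (\<Union>c\<in>C. cball (fst c) (5 * snd c))"
    by (rule Vitali_covering_lemma_cballs[OF cover rad]) (blast intro: that)+
  define X where "X = (\<lambda>c::complex\<times>real. cball (fst c) (5 * snd c) \<inter> cball 0 1)"
  define Y where "Y = (\<lambda>c::complex\<times>real. arc_set (fst c) (snd c) \<inter> {0..2*pi})"
  have X: "X c \<in> sets \<mu>" for c by (auto simp: X_def sets sets_restrict_space)
  have Y: "Y c \<in> sets N" for c
    by (simp add: Y_def N_def sets_circle_measure sets_restrict_space image_iff) (metis arc_set_borel inf_commute)
  have "E \<subseteq> (\<Union>c\<in>C. X c)" using cov by (auto simp: E_def X_def)
  then have "emeasure \<mu> E \<le> emeasure \<mu> (\<Union>c\<in>C. X c)"
    by (rule emeasure_mono) (use C X in \<open>auto intro!: sets.countable_UN'\<close>)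
  also have "\<dots> \<le> ennreal (1024 * K / sqrt \<tau>) * emeasure N (space N)"
  proof (rule emeasure_UN_le_disjoint[where Y = Y])
    \<comment> \<open>The arcs inherit disjointness from the selected balls.\<close>
    show "disjoint_family_on Y C"
      unfolding disjoint_family_on_def
    proof (intro ballI impI)
      fix c d assume "c \<in> C" "d \<in> C" "c \<noteq> d"
      then have "cball (fst c) (snd c) \<inter> cball (fst d) (snd d) = {}"
        using disj by (auto simp: pairwise_def disjnt_def)
      moreover have "cis \<theta> \<in> cball (fst c) (snd c)" if "\<theta> \<in> Y c" for \<theta> c
        using that by (simp add: Y_def arc_set_def dist_norm norm_minus_commute)
      ultimately show "Y c \<inter> Y d = {}" by blast
    qed
  next
    fix c assume "c \<in> C"
    then have c: "c \<in> Q" using C by auto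
    have sp: "space circle_measure = {0..2*pi}" by (simp add: circle_measure_def space_restrict_space)
    have "emeasure N (Y c) = (\<integral>\<^sup>+\<theta>. trunc_sqrt g \<tau> \<theta> * indicator (Y c) \<theta> \<partial>circle_measure)"
      unfolding N_def using Y[of c] by (intro emeasure_density measurable_circle_measureI) (auto simp: N_def)
    also have "\<dots> = (\<integral>\<^sup>+\<theta>. trunc_sqrt g \<tau> \<theta> * indicator (arc_set (fst c) (snd c)) \<theta> \<partial>circle_measure)"
      by (intro nn_integral_cong) (auto simp: Y_def sp indicator_def)
    finally have N: "ennreal (sqrt \<tau> * snd c / 64) \<le> emeasure N (Y c)"
      using c by (auto simp: Q_def intro: less_imp_le)
    have "emeasure \<mu> (X c) \<le> ennreal (16 * snd c * K)"
      unfolding X_def using c bound[OF c] by (intro win) (auto simp: Q_def)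
    \<comment> \<open>The length of the arc is traded for the mass that it carries.\<close>
    also have "16 * snd c * K = 1024 * K / sqrt \<tau> * (sqrt \<tau> * snd c / 64)"
      using tau by simp
    also have "ennreal \<dots> = ennreal (1024 * K / sqrt \<tau>) * ennreal (sqrt \<tau> * snd c / 64)"
      using tau K c by (intro ennreal_mult) (auto simp: Q_def)
    also have "\<dots> \<le> ennreal (1024 * K / sqrt \<tau>) * emeasure N (Y c)"
      by (intro mult_left_mono N) auto
    finally show "emeasure \<mu> (X c) \<le> ennreal (1024 * K / sqrt \<tau>) * emeasure N (Y c)" .
  qed (use C X Y in auto)
  also have "emeasure N (space N) = (\<integral>\<^sup>+\<theta>. trunc_sqrt g \<tau> \<theta> \<partial>circle_measure)"
  proof -
    have "emeasure N (space circle_measure) = (\<integral>\<^sup>+\<theta>. trunc_sqrt g \<tau> \<theta> * indicator (space circle_measure) \<theta> \<partial>circle_measure)"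
      unfolding N_def by (intro emeasure_density measurable_circle_measureI) auto
    also have "\<dots> = (\<integral>\<^sup>+\<theta>. trunc_sqrt g \<tau> \<theta> \<partial>circle_measure)"
      by (intro nn_integral_cong) auto
    finally show ?thesis by (simp add: N_def)
  qed
  finally show ?thesis by (simp add: E_def)
qed


section \<open>Orlicz functions and Luxemburg norms\<close>

lemma orlicz_zero: "orlicz \<Psi> \<Longrightarrow> \<Psi> 0 = 0"
  by (simp add: orlicz_def)

lemma orlicz_nonneg: "orlicz \<Psi> \<Longrightarrow> 0 \<le> x \<Longrightarrow> 0 \<le> \<Psi> x"
  by (simp add: orlicz_def)

lemma orlicz_less: "orlicz \<Psi> \<Longrightarrow> 0 \<le> x \<Longrightarrow> x < y \<Longrightarrow> \<Psi> x < \<Psi> y"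
  by (simp add: orlicz_def strict_mono_on_def)

lemma orlicz_mono: "orlicz \<Psi> \<Longrightarrow> 0 \<le> x \<Longrightarrow> x \<le> y \<Longrightarrow> \<Psi> x \<le> \<Psi> y"
  using orlicz_less[of \<Psi> x y] by (cases "x = y") auto

lemma orlicz_pos: "orlicz \<Psi> \<Longrightarrow> 0 < x \<Longrightarrow> 0 < \<Psi> x"
  using orlicz_less[of \<Psi> 0 x] by (simp add: orlicz_zero)

text \<open>Convexity between 0 and x, where \<Psi> vanishes at 0. The degenerate cases are separate
  because strict convexity speaks only of distinct points and 0 < t < 1.\<close>

lemma orlicz_scale:
  assumes O: "orlicz \<Psi>" and t: "0 \<le> t" "t \<le> 1" and x: "0 \<le> x"
  shows "\<Psi> (t * x) \<le> t * \<Psi> x"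
proof (cases "t = 0 \<or> t = 1 \<or> x = 0")
  case False
  have "strictly_convex_on {0..} \<Psi>" using O by (simp add: orlicz_def)
  moreover have "x \<in> {0..}" "(0::real) \<in> {0..}" "x \<noteq> 0 \<and> 0 < t \<and> t < 1" using t x False by auto
  ultimately have "\<Psi> (t * x + (1 - t) * 0) < t * \<Psi> x + (1 - t) * \<Psi> 0"
    unfolding strictly_convex_on_def by blast
  then show ?thesis by (simp add: orlicz_zero[OF O])
qed (use orlicz_zero[OF O] in auto)

lemma orlicz_div_mono:
  assumes O: "orlicz \<Psi>" and "0 < x" "x \<le> y"
  shows "\<Psi> x / x \<le> \<Psi> y / y"
  using orlicz_scale[OF O, of "x / y" y] assms(2,3) by (simp add: field_simps)

text \<open>Superlinear growth provides b \<ge> 1 with \<Psi> b \<ge> y; the intermediate value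
  theorem does the rest.\<close>

lemma orlicz_inv_ex:
  assumes O: "orlicz \<Psi>" and y: "0 \<le> y"
  shows "\<exists>x\<ge>0. \<Psi> x = y"
proof -
  have "filterlim (\<lambda>x. \<Psi> x / x) at_top at_top" using O by (simp add: orlicz_def)
  then have "\<forall>\<^sub>F x in at_top. y \<le> \<Psi> x / x" by (simp add: filterlim_at_top)
  moreover have "\<forall>\<^sub>F x in at_top. (1::real) \<le> x" by (rule eventually_ge_at_top)
  ultimately have "\<forall>\<^sub>F x in at_top. y \<le> \<Psi> x / x \<and> 1 \<le> x" by eventually_elim auto
  then have "\<exists>x. y \<le> \<Psi> x / x \<and> 1 \<le> x"
    by (rule eventually_happens'[OF trivial_limit_at_top_linorder])
  then obtain b where b: "y \<le> \<Psi> b / b" "1 \<le> b" by blast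
  have "\<Psi> b / b \<le> \<Psi> b / 1" using b orlicz_nonneg[OF O, of b] by (intro divide_left_mono) auto
  then have "y \<le> \<Psi> b" using b by simp
  moreover have "continuous_on {0..} \<Psi>" using O by (simp add: orlicz_def)
  then have "continuous_on {0..b} \<Psi>" by (rule continuous_on_subset) auto
  ultimately show ?thesis
    using IVT'[of \<Psi> 0 y b] y b orlicz_zero[OF O] by auto
qed

lemma orlicz_inj: "orlicz \<Psi> \<Longrightarrow> 0 \<le> x \<Longrightarrow> 0 \<le> y \<Longrightarrow> \<Psi> x = \<Psi> y \<Longrightarrow> x = y"
  using orlicz_less[of \<Psi> x y] orlicz_less[of \<Psi> y x] by (cases x y rule: linorder_cases) auto

lemma orlicz_inv_orlicz:
  assumes O: "orlicz \<Psi>" and x: "0 \<le> x"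
  shows "orlicz_inv \<Psi> (\<Psi> x) = x"
  unfolding orlicz_inv_def by (rule the_equality) (use orlicz_inj[OF O] x in auto)

lemma
  assumes O: "orlicz \<Psi>" and y: "0 \<le> y"
  shows orlicz_inv_nonneg: "0 \<le> orlicz_inv \<Psi> y" and orlicz_orlicz_inv: "\<Psi> (orlicz_inv \<Psi> y) = y"
proof -
  obtain x where "0 \<le> x" "\<Psi> x = y" using orlicz_inv_ex[OF O y] by blast
  then show "0 \<le> orlicz_inv \<Psi> y" "\<Psi> (orlicz_inv \<Psi> y) = y" using orlicz_inv_orlicz[OF O, of x] by auto
qed

lemma orlicz_inv_pos:
  assumes O: "orlicz \<Psi>" and y: "0 < y"
  shows "0 < orlicz_inv \<Psi> y"
  using orlicz_inv_nonneg[OF O, of y] orlicz_orlicz_inv[OF O, of y] y orlicz_zero[OF O]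
  by (cases "orlicz_inv \<Psi> y = 0") auto

text \<open>Values of \<Psi> at negative arguments are arbitrary. Composition with
  \<open>max 0\<close> gives a function continuous on the whole line, to which measurability and
  limit arguments apply.\<close>

lemma continuous_on_orlicz_max:
  assumes O: "orlicz \<Psi>"
  shows "continuous_on UNIV (\<lambda>x. \<Psi> (max 0 x))"
proof -
  have "continuous_on {0..} \<Psi>" using O by (simp add: orlicz_def)
  then show ?thesis by (rule continuous_on_compose2) (auto intro!: continuous_intros)
qed

lemma borel_measurable_orlicz:
  assumes O: "orlicz \<Psi>" and f: "f \<in> borel_measurable M" and pos: "\<And>x. 0 \<le> f x"
  shows "(\<lambda>x. \<Psi> (f x)) \<in> borel_measurable M"
proof -
  have "(\<lambda>x. \<Psi> (max 0 x)) \<in> borel_measurable borel"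
    by (intro borel_measurable_continuous_onI continuous_on_orlicz_max O)
  then have "(\<lambda>x. \<Psi> (max 0 (f x))) \<in> borel_measurable M"
    using f by (rule measurable_compose[rotated])
  then show ?thesis using pos by (simp add: max_absorb2)
qed

lemma lux_norm_le:
  assumes "0 < C" "(\<integral>\<^sup>+ x. ennreal (\<Psi> (norm (f x) / C)) \<partial>M) \<le> 1"
  shows "lux_norm \<Psi> M f \<le> C"
  unfolding lux_norm_def by (rule cInf_lower) (use assms in \<open>auto intro!: bdd_belowI[of _ 0]\<close>)

lemma lux_norm_nonneg: "in_orlicz \<Psi> M f \<Longrightarrow> 0 \<le> lux_norm \<Psi> M f"
  unfolding lux_norm_def in_orlicz_def by (rule cInf_greatest) auto

text \<open>A strict inequality yields an admissible constant below C, and monotonicity of \<Psi>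
  carries its bound to C; whether the infimum is attained does not enter.\<close>

lemma nn_integral_le_1_of_lux_norm_less:
  assumes O: "orlicz \<Psi>" and f: "in_orlicz \<Psi> M f" and less: "lux_norm \<Psi> M f < C"
  shows "(\<integral>\<^sup>+ x. ennreal (\<Psi> (norm (f x) / C)) \<partial>M) \<le> 1"
proof -
  let ?S = "{C. C > 0 \<and> (\<integral>\<^sup>+ x. ennreal (\<Psi> (norm (f x) / C)) \<partial>M) \<le> 1}"
  have "?S \<noteq> {}" using f by (auto simp: in_orlicz_def)
  then obtain D where D: "D > 0" "(\<integral>\<^sup>+ x. ennreal (\<Psi> (norm (f x) / D)) \<partial>M) \<le> 1" "D < C"
    using cInf_lessD[of ?S C] less by (auto simp: lux_norm_def)
  have "(\<integral>\<^sup>+ x. ennreal (\<Psi> (norm (f x) / C)) \<partial>M) \<le> (\<integral>\<^sup>+ x. ennreal (\<Psi> (norm (f x) / D)) \<partial>M)"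
    using D by (intro nn_integral_mono ennreal_leI orlicz_mono[OF O] divide_left_mono) auto
  then show ?thesis using D by simp
qed

section \<open>Carleson windows\<close>

text \<open>After rotating \<xi> to 1, the point w lies within 5 h \<le> 5/16 of 1. Hence Re w \<ge>
  1/2 and |Arg w| \<le> |Im w / Re w| \<le> 10 h.\<close>

lemma window_superset:
  assumes x: "norm \<xi> = 1" and h: "0 < h" "16 * h \<le> 1"
  shows "cball \<xi> (5 * h) \<inter> cball 0 1 \<subseteq> carleson_window \<xi> (16 * h)"
proof
  fix z assume z: "z \<in> cball \<xi> (5 * h) \<inter> cball 0 1"
  define w where "w = z * cnj \<xi>"
  have xx: "\<xi> * cnj \<xi> = 1" using x by (simp add: complex_norm_square[symmetric])
  have "w - 1 = (z - \<xi>) * cnj \<xi>" using xx by (simp add: w_def algebra_simps)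
  then have w: "norm (w - 1) \<le> 5 * h" using z x by (simp add: norm_mult dist_norm norm_minus_commute)
  have nw: "norm z = norm w" using x by (simp add: w_def norm_mult)
  have "1 - norm w \<le> norm (w - 1)" using norm_triangle_ineq2[of 1 w] by (simp add: norm_minus_commute)
  then have 1: "1 - 16 * h < norm z" using w h nw by simp
  have Im: "\<bar>Im w\<bar> \<le> 5 * h" using abs_Im_le_cmod[of "w - 1"] w by simp
  have "\<bar>Re w - 1\<bar> \<le> 5 * h" using abs_Re_le_cmod[of "w - 1"] w by simp
  then have Re: "Re w \<ge> 1/2" using h by simp
  have "Arg w = arctan (Im w / Re w)" using Re by (intro arg_conv_arctan) simp
  then have "\<bar>Arg w\<bar> \<le> \<bar>Im w / Re w\<bar>" by (simp only: abs_arctan_le)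
  also have "\<dots> \<le> 5 * h / (1/2)" unfolding abs_divide using Im Re h by (intro frac_le) auto
  finally have "\<bar>Arg w\<bar> < 16 * h" using h by simp
  then show "z \<in> carleson_window \<xi> (16 * h)" using 1 z by (simp add: carleson_window_def w_def)
qed

text \<open>An angle below h \<le> 1 < pi / 2 forces the rotated point into the right half-plane,
  away from the cut of \<open>Arg\<close>. The window is therefore relatively open in the closed
  disc.\<close>

lemma carleson_window_measurable:
  assumes "h \<le> 1" and x: "\<xi> \<noteq> 0"
  shows "carleson_window \<xi> h \<in> sets (restrict_space borel (cball (0::complex) 1))"
proof -
  have "open ({w. 0 < Re w} \<inter> Arg -` {-h<..<h})"
    by (intro continuous_open_preimage continuous_on_subset[OF continuous_on_Arg] open_halfspace_Re_gt)
      (auto simp: complex_nonpos_Reals_iff)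
  then have "open ((\<lambda>z. z * cnj \<xi>) -` ({w. 0 < Re w} \<inter> Arg -` {-h<..<h}))"
    by (intro open_vimage) (auto intro!: continuous_intros)
  moreover have "open {z::complex. 1 - h < norm z}" by (intro open_Collect_less continuous_intros)
  moreover define U where "U = {z. 1 - h < norm z} \<inter> (\<lambda>z. z * cnj \<xi>) -` ({w. 0 < Re w} \<inter> Arg -` {-h<..<h})"
  ultimately have "open U" by (auto intro!: open_Int)
  have eq: "carleson_window \<xi> h = cball 0 1 \<inter> U"
  proof -
    have "0 < Re (z * cnj \<xi>)" if "1 - h < norm z" "\<bar>Arg (z * cnj \<xi>)\<bar> < h" for z
    proof -
      have "\<bar>Arg (z * cnj \<xi>)\<bar> < pi / 2" using that assms pi_gt3 by linarith
      moreover have "z * cnj \<xi> \<noteq> 0" using that assms x by auto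
      ultimately show ?thesis using Arg_Re_pos by blast
    qed
    then show ?thesis by (auto simp: carleson_window_def U_def)
  qed
  show ?thesis unfolding eq sets_restrict_space by (rule imageI) (use \<open>open U\<close> in simp)
qed


section \<open>Test functions\<close>

lemma boundary_fun_eq:
  assumes "((\<lambda>r::real. f (of_real r * \<zeta>)) \<longlongrightarrow> l) (at_left 1)"
  shows "boundary_fun f \<zeta> = l"
proof -
  have "Lim (at_left 1) (\<lambda>r::real. f (of_real r * \<zeta>)) = l"
    by (rule tendsto_Lim[OF trivial_limit_at_left_real assms])
  then show ?thesis unfolding boundary_fun_def using assms by auto
qed

text \<open>By continuity r z \<longlonglongrightarrow> z gives the value f z as a radial limit at
  interior points too, so disc and circle need no separate treatment afterwards.\<close>

lemma disc_ext_eq_boundary_fun: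
  assumes f: "continuous_on (ball 0 1) f"
  shows "disc_ext f z = boundary_fun f z"
proof (cases "norm z < 1")
  case True
  have "isCont f z" using f True by (simp add: continuous_on_eq_continuous_at)
  moreover have "((\<lambda>r::real. of_real r * z) \<longlongrightarrow> of_real 1 * z) (at_left 1)"
    by (intro tendsto_intros)
  ultimately have "((\<lambda>r::real. f (of_real r * z)) \<longlongrightarrow> f z) (at_left 1)"
    by (intro isCont_tendsto_compose[of z f]) simp_all
  then show ?thesis using True by (simp add: boundary_fun_eq disc_ext_def)
qed (simp add: disc_ext_def)

lemma disc_ext_eq:
  assumes f: "continuous_on (cball 0 1) f" and z: "norm z \<le> 1"
  shows "disc_ext f z = f z"
proof -
  have "continuous_on {0..1} (\<lambda>r. f (of_real r * z))"
    by (intro continuous_intros continuous_on_compose2[OF f])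
      (use z in \<open>auto simp: norm_mult intro!: mult_le_one\<close>)
  then have "((\<lambda>r. f (of_real r * z)) \<longlongrightarrow> f (of_real 1 * z)) (at 1 within {0..1})"
    unfolding continuous_on_def by (rule bspec) simp
  moreover have "at (1::real) within {0..1} = at_left 1"
    by (rule at_within_Icc_at_left) simp
  ultimately have "((\<lambda>r. f (of_real r * z)) \<longlongrightarrow> f z) (at_left 1)" by simp
  moreover have "continuous_on (ball 0 1) f" by (rule continuous_on_subset[OF f]) auto
  ultimately show ?thesis by (simp add: boundary_fun_eq disc_ext_eq_boundary_fun)
qed

lemma norm_cis_minus_1_le: "norm (cis a - 1) \<le> \<bar>a\<bar>"
proof -
  have "(norm (cis a - 1))\<^sup>2 = 2 - 2 * cos a"
    unfolding cmod_power2 using sin_cos_squared_add[of a] by (simp add: power2_eq_square algebra_simps)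
  also have "\<dots> = (2 * \<bar>sin (a / 2)\<bar>)\<^sup>2"
    using cos_double_sin[of "a / 2"] by (simp add: power_mult_distrib)
  finally have "norm (cis a - 1) = 2 * \<bar>sin (a / 2)\<bar>"
    by (rule power2_eq_imp_eq) auto
  also have "\<dots> \<le> 2 * \<bar>a / 2\<bar>" by (intro mult_left_mono abs_sin_x_le_abs_x) auto
  finally show ?thesis by simp
qed

text \<open>A normalized Cauchy kernel, squared so that its modulus on circles about 0 is a multiple
  of a Poisson kernel.\<close>

definition test_fun :: "complex \<Rightarrow> real \<Rightarrow> complex \<Rightarrow> complex" where
  "test_fun \<xi> h z = (of_real h / (1 - cnj (of_real (1 - h) * \<xi>) * z))\<^sup>2"

context
  fixes \<xi> :: complex and h :: real
  assumes xi: "norm \<xi> = 1" and h: "0 < h" "h \<le> 1"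
begin

lemma norm_test_pole: "norm (of_real (1 - h) * \<xi>) = 1 - h"
  unfolding norm_mult norm_of_real using xi h by auto

lemma test_fun_denominator: "norm z \<le> 1 \<Longrightarrow> 1 - cnj (of_real (1 - h) * \<xi>) * z \<noteq> 0"
  by (rule one_minus_cnj_mult_nonzero) (use norm_test_pole h in auto)

lemma test_fun_holomorphic: "test_fun \<xi> h holomorphic_on ball 0 1"
  unfolding test_fun_def[abs_def]
  by (intro holomorphic_intros) (use test_fun_denominator in auto)

lemma test_fun_continuous: "continuous_on (cball 0 1) (test_fun \<xi> h)"
  unfolding test_fun_def[abs_def]
  by (intro continuous_intros) (use test_fun_denominator in auto)

lemma test_fun_le_1:
  assumes "norm z \<le> 1"
  shows "norm (test_fun \<xi> h z) \<le> 1"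
proof -
  have "norm (cnj (of_real (1 - h) * \<xi>) * z) \<le> (1 - h) * 1"
    unfolding norm_mult[of _ z] complex_mod_cnj norm_test_pole using assms h by (intro mult_left_mono) auto
  then have "h \<le> norm (1 - cnj (of_real (1 - h) * \<xi>) * z)"
    using norm_triangle_ineq2[of 1 "cnj (of_real (1 - h) * \<xi>) * z"] by simp
  then have "h / norm (1 - cnj (of_real (1 - h) * \<xi>) * z) \<le> 1" using h by (subst pos_divide_le_eq) linarith+
  then show ?thesis using h
    unfolding test_fun_def norm_power norm_divide norm_of_real by (intro power_le_one) auto
qed

text \<open>On the window the denominator is at most 3 h in modulus: at most 2 h comes from the
  radii and at most h from the angle.\<close>

lemma test_fun_ge_on_window:
  assumes z: "z \<in> carleson_window \<xi> h"
  shows "1 / 9 \<le> norm (test_fun \<xi> h z)"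
proof -
  define w where "w = z * cnj \<xi>"
  define s where "s = norm z"
  define a where "a = Arg w"
  have s: "1 - h < s" "s \<le> 1" and a: "\<bar>a\<bar> < h"
    using z by (auto simp: carleson_window_def s_def a_def w_def)
  have ws: "norm w = s" using xi by (simp add: w_def s_def norm_mult)
  have wp: "w = of_real s * cis a" using rcis_cmod_Arg[of w] by (simp add: rcis_def ws a_def)
  have rs: "0 \<le> (1 - h) * s" "(1 - h) * s \<le> 1" using s h by (auto intro: mult_le_one)
  have "1 - of_real (1 - h) * w = of_real (1 - (1 - h) * s) - of_real ((1 - h) * s) * (cis a - 1)"
    by (simp add: wp algebra_simps)
  then have "norm (1 - of_real (1 - h) * w) \<le> norm (of_real (1 - (1 - h) * s) :: complex) + norm (of_real ((1 - h) * s) * (cis a - 1))"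
    by (metis norm_triangle_ineq4)
  also have "\<dots> = (1 - (1 - h) * s) + (1 - h) * s * norm (cis a - 1)"
    unfolding norm_mult norm_of_real using rs by simp
  also have "\<dots> \<le> (1 - (1 - h) * (1 - h)) + 1 * \<bar>a\<bar>"
    using rs s h norm_cis_minus_1_le[of a] by (intro add_mono diff_left_mono mult_mono) auto
  also have "\<dots> \<le> 3 * h"
  proof -
    have "1 - (1 - h) * (1 - h) = 2 * h - h * h" by (simp add: algebra_simps)
    then show ?thesis using a zero_le_square[of h] by linarith
  qed
  finally have le: "norm (1 - of_real (1 - h) * w) \<le> 3 * h" .
  have eq: "1 - cnj (of_real (1 - h) * \<xi>) * z = 1 - of_real (1 - h) * w"
    by (simp add: w_def mult_ac)
  have "norm z \<le> 1" using s by (simp add: s_def)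
  from test_fun_denominator[OF this] have "0 < norm (1 - of_real (1 - h) * w)"
    unfolding eq by (simp only: zero_less_norm_iff not_False_eq_True)
  then have "1 / 3 \<le> h / norm (1 - of_real (1 - h) * w)" using le h by (simp add: field_simps)
  then have "(1 / 3)\<^sup>2 \<le> (h / norm (1 - of_real (1 - h) * w))\<^sup>2" by (intro power_mono) auto
  then show ?thesis unfolding test_fun_def norm_power norm_divide norm_of_real eq
    using h by (simp add: power2_eq_square)
qed

text \<open>On the circle of radius s the modulus is h^2 / (1 - \<rho>^2) times the Poisson kernel
  at a point of norm \<rho> = s (1 - h). The kernel has mean 1, and 1 - \<rho>^2 \<ge> 1 - \<rho>
  \<ge> h.\<close>

lemma test_fun_mean_le:
  assumes s: "0 \<le> s" "s < 1"
  shows "(\<integral>\<^sup>+\<theta>. ennreal (norm (test_fun \<xi> h (of_real s * cis \<theta>))) \<partial>circle_measure) \<le> ennreal h"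
proof -
  define a where "a = of_real s * (of_real (1 - h) * \<xi>)"
  define \<rho> where "\<rho> = s * (1 - h)"
  have na: "norm a = \<rho>" unfolding a_def \<rho>_def norm_mult[of "of_real s"] norm_test_pole using s by simp
  have "\<rho> \<le> 1 * (1 - h)" unfolding \<rho>_def using s h by (intro mult_right_mono) auto
  then have \<rho>: "0 \<le> \<rho>" "\<rho> \<le> 1 - h" using s h by (auto simp: \<rho>_def)
  have a1: "norm a < 1" using na \<rho> h by simp
  have "\<rho>\<^sup>2 \<le> \<rho> * 1" unfolding power2_eq_square using \<rho> h by (intro mult_left_mono) auto
  then have den: "h \<le> 1 - \<rho>\<^sup>2" using \<rho> by simp
  have eq: "norm (test_fun \<xi> h (of_real s * cis \<theta>)) = h\<^sup>2 / (1 - \<rho>\<^sup>2) * poisson_kernel a (cis \<theta>)" for \<theta>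
  proof -
    have eqd: "1 - cnj (of_real (1 - h) * \<xi>) * (of_real s * cis \<theta>) = 1 - cnj a * cis \<theta>"
      by (simp add: a_def mult_ac)
    have "norm (test_fun \<xi> h (of_real s * cis \<theta>)) = h\<^sup>2 / (norm (cis \<theta> - a))\<^sup>2"
      unfolding test_fun_def eqd norm_power norm_divide norm_of_real norm_cis_diff by (simp add: power_divide)
    then show ?thesis using den h by (simp add: poisson_kernel_def na)
  qed
  have c: "0 \<le> h\<^sup>2 / (1 - \<rho>\<^sup>2)" using den h by auto
  have "(\<integral>\<^sup>+\<theta>. ennreal (norm (test_fun \<xi> h (of_real s * cis \<theta>))) \<partial>circle_measure)
      = (\<integral>\<^sup>+\<theta>. ennreal (h\<^sup>2 / (1 - \<rho>\<^sup>2)) * ennreal (poisson_kernel a (cis \<theta>)) \<partial>circle_measure)"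
    unfolding eq using c a1 by (intro nn_integral_cong ennreal_mult) (auto simp: poisson_kernel_nonneg)
  also have "\<dots> = ennreal (h\<^sup>2 / (1 - \<rho>\<^sup>2))"
    using nn_integral_poisson_kernel[OF a1] borel_measurable_poisson_kernel_cis[OF a1]
    by (subst nn_integral_cmult) (auto intro!: measurable_circle_measureI)
  also have "\<dots> \<le> ennreal (h\<^sup>2 / h)"
    using den h by (intro ennreal_leI divide_left_mono) auto
  also have "\<dots> = ennreal h" using h by (simp add: power2_eq_square)
  finally show ?thesis .
qed

text \<open>With L the inverse value at 1 / h and |u| \<le> 1, convexity gives \<Psi> (|u| L) \<le>
  |u| \<Psi> L = |u| / h, whose mean is at most 1.\<close>

lemma test_fun_in_hardy_orlicz:
  assumes O: "orlicz \<Psi>"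
  shows "in_hardy_orlicz \<Psi> (test_fun \<xi> h)" "hardy_norm \<Psi> (test_fun \<xi> h) \<le> 1 / orlicz_inv \<Psi> (1 / h)"
proof -
  define L where "L = orlicz_inv \<Psi> (1 / h)"
  have L: "0 < L" "\<Psi> L = 1 / h" using h orlicz_inv_pos[OF O] orlicz_orlicz_inv[OF O] by (auto simp: L_def)
  have meas: "(\<lambda>\<theta>. test_fun \<xi> h (of_real s * cis \<theta>)) \<in> borel_measurable circle_measure" if "s \<in> {0..<1}" for s
    using that by (intro measurable_circle_measureI borel_measurable_continuous_onI
        continuous_on_compose2[OF test_fun_continuous]) (auto intro!: continuous_intros simp: norm_mult)
  have int: "(\<integral>\<^sup>+ \<theta>. ennreal (\<Psi> (norm (test_fun \<xi> h (of_real s * cis \<theta>)) / (1 / L))) \<partial>circle_measure) \<le> 1"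
    if s: "s \<in> {0..<1}" for s
  proof -
    have "ennreal (\<Psi> (norm (test_fun \<xi> h (of_real s * cis \<theta>)) / (1 / L))) \<le>
        ennreal (1 / h) * ennreal (norm (test_fun \<xi> h (of_real s * cis \<theta>)))" for \<theta>
    proof -
      have "norm (test_fun \<xi> h (of_real s * cis \<theta>)) \<le> 1"
        using s by (intro test_fun_le_1) (auto simp: norm_mult)
      from orlicz_scale[OF O _ this, of L] L
      have "\<Psi> (norm (test_fun \<xi> h (of_real s * cis \<theta>)) * L) \<le> 1 / h * norm (test_fun \<xi> h (of_real s * cis \<theta>))"
        by simp
      then show ?thesis using h by (subst ennreal_mult[symmetric]) (auto intro!: ennreal_leI)
    qed
    then have "(\<integral>\<^sup>+ \<theta>. ennreal (\<Psi> (norm (test_fun \<xi> h (of_real s * cis \<theta>)) / (1 / L))) \<partial>circle_measure)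
      \<le> (\<integral>\<^sup>+ \<theta>. ennreal (1 / h) * ennreal (norm (test_fun \<xi> h (of_real s * cis \<theta>))) \<partial>circle_measure)"
      by (intro nn_integral_mono)
    also have "\<dots> = ennreal (1 / h) * (\<integral>\<^sup>+ \<theta>. ennreal (norm (test_fun \<xi> h (of_real s * cis \<theta>))) \<partial>circle_measure)"
      by (intro nn_integral_cmult measurable_compose[OF meas[OF s], of "\<lambda>z. ennreal (norm z)"]) measurable
    also have "\<dots> \<le> ennreal (1 / h) * ennreal h"
      using s by (intro mult_left_mono test_fun_mean_le) auto
    also have "\<dots> = 1" using h by (subst ennreal_mult[symmetric]) auto
    finally show ?thesis .
  qed
  have lux: "lux_norm \<Psi> circle_measure (\<lambda>\<theta>. test_fun \<xi> h (of_real s * cis \<theta>)) \<le> 1 / L" if "s \<in> {0..<1}" for s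
    using int[OF that] L by (intro lux_norm_le) auto
  show "in_hardy_orlicz \<Psi> (test_fun \<xi> h)"
    unfolding in_hardy_orlicz_def
  proof (intro conjI ballI test_fun_holomorphic)
    fix s :: real assume "s \<in> {0..<1}"
    then show "in_orlicz \<Psi> circle_measure (\<lambda>\<theta>. test_fun \<xi> h (of_real s * cis \<theta>))"
      unfolding in_orlicz_def using meas int L by (intro conjI exI[of _ "1 / L"]) auto
  next
    show "bdd_above ((\<lambda>s. lux_norm \<Psi> circle_measure (\<lambda>\<theta>. test_fun \<xi> h (of_real s * cis \<theta>))) ` {0..<1})"
      using lux by (intro bdd_aboveI2)
  qed
  show "hardy_norm \<Psi> (test_fun \<xi> h) \<le> 1 / orlicz_inv \<Psi> (1 / h)"
    unfolding hardy_norm_def L_def[symmetric] by (rule cSUP_least) (use lux in auto)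
qed

end

section \<open>Necessity of the window condition\<close>

lemma hardy_norm_nonneg:
  assumes f: "in_hardy_orlicz \<Psi> f"
  shows "0 \<le> hardy_norm \<Psi> f"
proof -
  have "0 \<le> lux_norm \<Psi> circle_measure (\<lambda>\<theta>. f (of_real 0 * cis \<theta>))"
    using f unfolding in_hardy_orlicz_def by (intro lux_norm_nonneg) (metis atLeastLessThan_iff order_refl zero_less_one)
  also have "\<dots> \<le> hardy_norm \<Psi> f"
    using f unfolding in_hardy_orlicz_def hardy_norm_def by (intro cSUP_upper) auto
  finally show ?thesis .
qed

text \<open>Chebyshev's inequality for the test function on its window, combined with the norm bound
  from the embedding.\<close>

lemma rho_mu_le_of_embeds:
  assumes fin: "finite_measure \<mu>"
    and sets: "sets \<mu> = sets (restrict_space borel (cball (0::complex) 1))"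
    and O1: "orlicz \<Psi>1" and O2: "orlicz \<Psi>2" and emb: "hardy_orlicz_embeds \<Psi>1 \<Psi>2 \<mu>"
  shows "\<exists>A>0. \<forall>h\<in>{0<..1}. rho_mu \<mu> h \<le> 1 / \<Psi>2 (A * orlicz_inv \<Psi>1 (1 / h))"
proof -
  interpret finite_measure \<mu> by (rule fin)
  obtain C where C: "\<And>f. in_hardy_orlicz \<Psi>1 f \<Longrightarrow> lux_norm \<Psi>2 \<mu> (disc_ext f) \<le> C * hardy_norm \<Psi>1 f"
    and mem: "\<And>f. in_hardy_orlicz \<Psi>1 f \<Longrightarrow> in_orlicz \<Psi>2 \<mu> (disc_ext f)"
    using emb unfolding hardy_orlicz_embeds_def by blast
  \<comment> \<open>The constant of the embedding is an arbitrary real; M replaces it by a positive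
    one.\<close>
  define M where "M = max C 1"
  have M: "M > 0" "C \<le> M" by (auto simp: M_def)
  \<comment> \<open>Here 18 = 9 * 2: the 9 comes from the lower bound on the window, the 2 makes the
    norm inequality strict.\<close>
  have "rho_mu \<mu> h \<le> 1 / \<Psi>2 (1 / (18 * M) * orlicz_inv \<Psi>1 (1 / h))" if "h \<in> {0<..1}" for h
    unfolding rho_mu_def
  proof (rule cSUP_least)
    fix \<xi> :: complex assume "\<xi> \<in> sphere 0 1"
    then have x: "norm \<xi> = 1" by simp
    have h: "0 < h" "h \<le> 1" using that by auto
    define L where "L = orlicz_inv \<Psi>1 (1 / h)"
    have L: "0 < L" using h orlicz_inv_pos[OF O1] by (auto simp: L_def)
    note u = test_fun_in_hardy_orlicz[OF x h O1]
    note nonneg = hardy_norm_nonneg[OF u(1)]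
    have "lux_norm \<Psi>2 \<mu> (disc_ext (test_fun \<xi> h)) \<le> C * hardy_norm \<Psi>1 (test_fun \<xi> h)"
      by (rule C[OF u(1)])
    also have "\<dots> \<le> M * (1 / L)" using M u(2) nonneg by (intro mult_mono) (auto simp: L_def)
    also have "\<dots> < 2 * M / L" using M L by (simp add: field_simps)
    finally have int: "(\<integral>\<^sup>+ z. ennreal (\<Psi>2 (norm (disc_ext (test_fun \<xi> h) z) / (2 * M / L))) \<partial>\<mu>) \<le> 1"
      by (rule nn_integral_le_1_of_lux_norm_less[OF O2 mem[OF u(1)]])
    define b where "b = \<Psi>2 (1 / (18 * M) * L)"
    have b: "b > 0" unfolding b_def using M L by (intro orlicz_pos[OF O2]) auto
    have W: "carleson_window \<xi> h \<in> sets \<mu>"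
      unfolding sets using x h by (intro carleson_window_measurable) auto
    have "ennreal b * emeasure \<mu> (carleson_window \<xi> h) = (\<integral>\<^sup>+ z. ennreal b * indicator (carleson_window \<xi> h) z \<partial>\<mu>)"
      using W by (simp add: nn_integral_cmult_indicator)
    also have "\<dots> \<le> (\<integral>\<^sup>+ z. ennreal (\<Psi>2 (norm (disc_ext (test_fun \<xi> h) z) / (2 * M / L))) \<partial>\<mu>)"
    proof (rule nn_integral_mono)
      fix z
      have "b \<le> \<Psi>2 (norm (disc_ext (test_fun \<xi> h) z) / (2 * M / L))" if z: "z \<in> carleson_window \<xi> h"
      proof -
        have "norm z \<le> 1" using z by (simp add: carleson_window_def)
        then have "disc_ext (test_fun \<xi> h) z = test_fun \<xi> h z"
          by (rule disc_ext_eq[OF test_fun_continuous[OF x h]])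
        then have "1 / 9 \<le> norm (disc_ext (test_fun \<xi> h) z)" using test_fun_ge_on_window[OF x h z] by simp
        then have "1 / 9 / (2 * M / L) \<le> norm (disc_ext (test_fun \<xi> h) z) / (2 * M / L)"
          using M L by (intro divide_right_mono) auto
        then show ?thesis unfolding b_def using M L by (intro orlicz_mono[OF O2]) (auto simp: field_simps)
      qed
      then show "ennreal b * indicator (carleson_window \<xi> h) z \<le> ennreal (\<Psi>2 (norm (disc_ext (test_fun \<xi> h) z) / (2 * M / L)))"
        by (auto simp: indicator_def intro: ennreal_leI)
    qed
    also note int
    finally have "ennreal (b * measure \<mu> (carleson_window \<xi> h)) \<le> ennreal 1"
      using b by (simp add: emeasure_eq_measure ennreal_mult)
    then have "b * measure \<mu> (carleson_window \<xi> h) \<le> 1" by (subst (asm) ennreal_le_iff) auto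
    then have "measure \<mu> (carleson_window \<xi> h) \<le> 1 / b" using b by (simp add: field_simps)
    then show "measure \<mu> (carleson_window \<xi> h) \<le> 1 / \<Psi>2 (1 / (18 * M) * orlicz_inv \<Psi>1 (1 / h))"
      by (simp add: b_def L_def)
  qed auto
  then show ?thesis using M by (intro exI[of _ "1 / (18 * M)"]) auto
qed


section \<open>The modular estimate\<close>

text \<open>\<open>K_mu\<close> at the one scale H controls every window of size at most H, being a
  supremum over all smaller scales.\<close>

lemma emeasure_window_le:
  assumes fin: "finite_measure \<mu>"
    and sets: "sets \<mu> = sets (restrict_space borel (cball (0::complex) 1))"
    and x: "norm \<xi> = 1" and h: "0 < h" "16 * h \<le> H" "H \<le> 1"
    and K: "K_mu \<mu> H \<le> ereal k"
  shows "emeasure \<mu> (cball \<xi> (5 * h) \<inter> cball 0 1) \<le> ennreal (16 * h * k)"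
proof -
  interpret finite_measure \<mu> by (rule fin)
  define t where "t = 16 * h"
  have t: "0 < t" "t \<le> H" "t \<le> 1" using h by (auto simp: t_def)
  have W: "carleson_window \<xi> t \<in> sets \<mu>"
    unfolding sets using x t by (intro carleson_window_measurable) auto
  have "ereal (rho_mu \<mu> t / t) \<le> K_mu \<mu> H"
    unfolding K_mu_def by (intro SUP_upper) (use t in auto)
  then have "rho_mu \<mu> t / t \<le> k" using K order_trans by fastforce
  then have rho: "rho_mu \<mu> t \<le> t * k" using t by (simp add: field_simps)
  have "measure \<mu> (carleson_window \<xi> t) \<le> rho_mu \<mu> t"
    unfolding rho_mu_def
  proof (rule cSUP_upper)
    \<comment> \<open>A supremum of reals dominates its members only if the family is bounded; the
      total mass is a bound.\<close>
    show "bdd_above ((\<lambda>\<xi>. measure \<mu> (carleson_window \<xi> t)) ` sphere 0 1)"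
      by (rule bdd_aboveI2[of _ _ "measure \<mu> (space \<mu>)"]) (rule bounded_measure)
  qed (use x in auto)
  also note rho
  finally have m: "measure \<mu> (carleson_window \<xi> t) \<le> t * k" .
  have "emeasure \<mu> (cball \<xi> (5 * h) \<inter> cball 0 1) \<le> emeasure \<mu> (carleson_window \<xi> t)"
    unfolding t_def by (intro emeasure_mono window_superset x h) (use h W in \<open>auto simp: t_def\<close>)
  also have "\<dots> = ennreal (measure \<mu> (carleson_window \<xi> t))" by (simp add: emeasure_eq_measure)
  also have "\<dots> \<le> ennreal (t * k)" by (intro ennreal_leI m)
  finally show ?thesis by (simp add: t_def)
qed

text \<open>For x > \<tau>, sqrt x \<le> x / sqrt \<tau> = sqrt \<tau> (x / \<tau>), and x / \<tau>
  \<le> \<Psi> x / \<Psi> \<tau> because \<Psi> x / x increases.\<close>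

lemma trunc_sqrt_integral_le:
  assumes O: "orlicz \<Psi>" and cont: "continuous_on (cball 0 1) g" and tau: "0 < \<tau>"
    and int: "(\<integral>\<^sup>+\<theta>. ennreal (\<Psi> (norm (g (cis \<theta>)))) \<partial>circle_measure) \<le> 1"
  shows "(\<integral>\<^sup>+\<theta>. trunc_sqrt g \<tau> \<theta> \<partial>circle_measure) \<le> ennreal (sqrt \<tau> / \<Psi> \<tau>)"
proof -
  have P: "0 < \<Psi> \<tau>" by (rule orlicz_pos[OF O tau])
  have "trunc_sqrt g \<tau> \<theta> \<le> ennreal (sqrt \<tau> / \<Psi> \<tau>) * ennreal (\<Psi> (norm (g (cis \<theta>))))" for \<theta>
  proof (cases "\<tau> < norm (g (cis \<theta>))")
    case True
    define x where "x = norm (g (cis \<theta>))"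
    have x: "\<tau> < x" "0 < x" using True tau by (auto simp: x_def)
    have "sqrt x * sqrt \<tau> \<le> sqrt x * sqrt x" using x by (intro mult_left_mono) auto
    then have "sqrt x \<le> x / sqrt \<tau>" using x tau by (simp add: field_simps)
    also have "\<dots> = sqrt \<tau> * (x / \<tau>)"
      using tau real_sqrt_mult_self[of \<tau>] by (simp add: field_simps)
    also have "\<dots> \<le> sqrt \<tau> * (\<Psi> x / \<Psi> \<tau>)"
    proof -
      have "\<Psi> \<tau> / \<tau> \<le> \<Psi> x / x" using x tau by (intro orlicz_div_mono[OF O]) auto
      then have "x / \<tau> \<le> \<Psi> x / \<Psi> \<tau>" using x tau P by (simp add: field_simps)
      then show ?thesis using tau by (intro mult_left_mono) auto
    qed
    finally have "sqrt x \<le> sqrt \<tau> / \<Psi> \<tau> * \<Psi> x" by simp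
    then show ?thesis using tau P orlicz_nonneg[OF O, of x] x True
      by (subst ennreal_mult[symmetric]) (auto simp: trunc_sqrt_def x_def[symmetric] intro!: ennreal_leI)
  qed (simp add: trunc_sqrt_def)
  then have "(\<integral>\<^sup>+\<theta>. trunc_sqrt g \<tau> \<theta> \<partial>circle_measure) \<le>
      (\<integral>\<^sup>+\<theta>. ennreal (sqrt \<tau> / \<Psi> \<tau>) * ennreal (\<Psi> (norm (g (cis \<theta>)))) \<partial>circle_measure)"
    by (intro nn_integral_mono)
  also have "\<dots> = ennreal (sqrt \<tau> / \<Psi> \<tau>) * (\<integral>\<^sup>+\<theta>. ennreal (\<Psi> (norm (g (cis \<theta>)))) \<partial>circle_measure)"
  proof (rule nn_integral_cmult)
    have "(\<lambda>\<theta>. \<Psi> (norm (g (cis \<theta>)))) \<in> borel_measurable circle_measure"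
    proof (rule borel_measurable_orlicz[OF O])
      show "(\<lambda>\<theta>. norm (g (cis \<theta>))) \<in> borel_measurable circle_measure"
        by (intro measurable_circle_measureI
            measurable_compose[OF borel_measurable_cis_compose[OF cont] borel_measurable_norm])
    qed simp
    then show "(\<lambda>\<theta>. ennreal (\<Psi> (norm (g (cis \<theta>))))) \<in> borel_measurable circle_measure" by simp
  qed
  also have "\<dots> \<le> ennreal (sqrt \<tau> / \<Psi> \<tau>) * 1" by (intro mult_left_mono int) auto
  finally show ?thesis by simp
qed

text \<open>The weak-type estimate at \<tau> = 1024 \<sigma> and H = 1 / \<Psi>1 \<sigma>. Since
  \<Psi>1 (1024 \<sigma>) \<ge> 1024 \<Psi>1 \<sigma>, the total mass is small enough for this H, at
  which the hypothesis on \<open>K_mu\<close> reads \<Psi>1 \<sigma> / \<Psi>2 (A \<sigma>).\<close>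

lemma level_set_measure_le:
  assumes fin: "finite_measure \<mu>"
    and sets: "sets \<mu> = sets (restrict_space borel (cball (0::complex) 1))"
    and O1: "orlicz \<Psi>1" and O2: "orlicz \<Psi>2" and A: "A > 0"
    and K: "\<And>h. h \<in> {0<..1} \<Longrightarrow> K_mu \<mu> h \<le> ereal ((1 / h) / \<Psi>2 (A * orlicz_inv \<Psi>1 (1 / h)))"
    and cont: "continuous_on (cball 0 1) g"
    and sub: "\<And>z. norm z < 1 \<Longrightarrow> ennreal (sqrt (norm (g z))) \<le>
      (\<integral>\<^sup>+\<theta>. ennreal (sqrt (norm (g (cis \<theta>))) * poisson_kernel z (cis \<theta>)) \<partial>circle_measure)"
    and int: "(\<integral>\<^sup>+\<theta>. ennreal (\<Psi>1 (norm (g (cis \<theta>)))) \<partial>circle_measure) \<le> 1"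
    and s: "0 < \<sigma>" "1 \<le> \<Psi>1 \<sigma>"
  shows "emeasure \<mu> {z\<in>cball 0 1. 4096 * \<sigma> < norm (g z)} \<le>
    ennreal (32 * (\<Psi>1 \<sigma> / \<Psi>2 (A * \<sigma>)) / sqrt \<sigma>) * (\<integral>\<^sup>+\<theta>. trunc_sqrt g \<sigma> \<theta> \<partial>circle_measure)"
proof -
  define \<tau> where "\<tau> = 1024 * \<sigma>"
  define H where "H = 1 / \<Psi>1 \<sigma>"
  define k where "k = \<Psi>1 \<sigma> / \<Psi>2 (A * \<sigma>)"
  have tau: "0 < \<tau>" "\<sigma> \<le> \<tau>" using s by (auto simp: \<tau>_def)
  have H: "0 < H" "H \<le> 1" using s by (auto simp: H_def)
  have k: "0 \<le> k" unfolding k_def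
    using s A orlicz_nonneg[OF O1, of \<sigma>] orlicz_nonneg[OF O2, of "A * \<sigma>"] by simp
  have "K_mu \<mu> H \<le> ereal ((1 / H) / \<Psi>2 (A * orlicz_inv \<Psi>1 (1 / H)))" using H by (intro K) auto
  moreover have "(1 / H) / \<Psi>2 (A * orlicz_inv \<Psi>1 (1 / H)) = k"
    using s by (simp add: H_def k_def orlicz_inv_orlicz[OF O1])
  ultimately have KH: "K_mu \<mu> H \<le> ereal k" by simp
  have sq: "sqrt \<tau> = 32 * sqrt \<sigma>"
    unfolding \<tau>_def real_sqrt_mult using real_sqrt_pow2[of 32] real_sqrt_abs[of 32] by simp
  have "(\<integral>\<^sup>+\<theta>. trunc_sqrt g \<tau> \<theta> \<partial>circle_measure) \<le> ennreal (sqrt \<tau> / \<Psi>1 \<tau>)"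
    by (rule trunc_sqrt_integral_le[OF O1 cont tau(1) int])
  also have "\<dots> \<le> ennreal (sqrt \<tau> * H / 1024)"
  proof (rule ennreal_leI)
    have "\<Psi>1 \<sigma> \<le> 1 / 1024 * \<Psi>1 \<tau>"
      using orlicz_scale[OF O1, of "1/1024" \<tau>] tau by (simp add: \<tau>_def)
    then have "sqrt \<tau> / \<Psi>1 \<tau> \<le> sqrt \<tau> / (1024 * \<Psi>1 \<sigma>)"
      using s tau by (intro divide_left_mono) (auto intro!: mult_pos_pos)
    then show "sqrt \<tau> / \<Psi>1 \<tau> \<le> sqrt \<tau> * H / 1024" by (simp add: H_def)
  qed
  finally have tot: "(\<integral>\<^sup>+\<theta>. trunc_sqrt g \<tau> \<theta> \<partial>circle_measure) \<le> ennreal (sqrt \<tau> * H / 1024)" .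
  have "emeasure \<mu> {z\<in>cball 0 1. 4 * \<tau> < norm (g z)} \<le>
      ennreal (1024 * k / sqrt \<tau>) * (\<integral>\<^sup>+\<theta>. trunc_sqrt g \<tau> \<theta> \<partial>circle_measure)"
  proof (rule weak_type_estimate[OF sets cont sub tau(1) k _ tot])
    show "emeasure \<mu> (cball \<xi> (5 * h) \<inter> cball 0 1) \<le> ennreal (16 * h * k)"
      if "norm \<xi> = 1" "0 < h" "16 * h \<le> H" for \<xi> h
      by (rule emeasure_window_le[OF fin sets that H(2) KH])
  qed (use H in auto)
  \<comment> \<open>Truncating at the lower height \<sigma> only enlarges the integrand and leaves a
    single parameter for the later sum.\<close>
  also have "\<dots> \<le> ennreal (1024 * k / sqrt \<tau>) * (\<integral>\<^sup>+\<theta>. trunc_sqrt g \<sigma> \<theta> \<partial>circle_measure)"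
    using tau by (intro mult_left_mono nn_integral_mono) (auto simp: trunc_sqrt_def indicator_def)
  also have "1024 * k / sqrt \<tau> = 32 * k / sqrt \<sigma>" using s by (simp add: sq)
  finally show ?thesis by (simp add: \<tau>_def k_def)
qed

section \<open>Summation over geometric levels\<close>

lemma least_power_scale:
  fixes x s :: real
  assumes "0 < s" "s < x"
  obtains n where "4 ^ n * s < x" "x \<le> 4 ^ Suc n * s"
proof -
  obtain m where m: "x / s < 4 ^ m" using real_arch_pow[of 4 "x / s"] by auto
  define n where "n = (LEAST n. x \<le> 4 ^ n * s)"
  have n: "x \<le> 4 ^ n * s"
    unfolding n_def by (rule LeastI[of _ m]) (use m assms in \<open>simp add: field_simps\<close>)
  obtain j where j: "n = Suc j" using n assms by (cases n) auto
  have "\<not> x \<le> 4 ^ j * s" using not_less_Least[of j "\<lambda>n. x \<le> 4 ^ n * s"] j by (simp add: n_def)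
  then show ?thesis using that[of j] n j by auto
qed

text \<open>For a level y < x the term is (\<Psi> y / y) sqrt (x y) \<le> \<Psi> x sqrt (y / x), and
  sqrt y grows geometrically with ratio 2 up to at most sqrt x. With x / y in place of sqrt (x / y)
  each term would only be bounded by \<Psi> x, without decay.\<close>

lemma trunc_sqrt_sum_le:
  assumes O: "orlicz \<Psi>" and s: "0 < s" and x: "0 \<le> x"
  shows "(\<Sum>k. ennreal (\<Psi> (4 ^ k * s) / sqrt (4 ^ k * s)) * (ennreal (sqrt x) * indicator {..<x} (4 ^ k * s)))
    \<le> ennreal (2 * \<Psi> x)"
proof (cases "s < x")
  case False
  have "s \<le> 4 ^ k * s" for k using s by simp
  then have "\<not> 4 ^ k * s < x" for k using False by (meson linorder_not_less order_trans)
  then show ?thesis by (simp add: indicator_def)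
next
  case True
  obtain n where n: "4 ^ n * s < x" "x \<le> 4 ^ Suc n * s" using least_power_scale[OF s True] .
  have x0: "x > 0" using s True by simp
  have sq: "sqrt (4 ^ k * s) = 2 ^ k * sqrt s" for k
  proof -
    have "sqrt (4 ^ k) = 2 ^ k" by (simp add: real_sqrt_power)
    then show ?thesis by (simp add: real_sqrt_mult)
  qed
  have mono: "4 ^ k * s \<le> 4 ^ n * s" if "k \<le> n" for k
    using that s by (intro mult_right_mono power_increasing) auto
  have out: "\<not> 4 ^ k * s < x" if "\<not> k \<le> n" for k
  proof -
    have "4 ^ Suc n * s \<le> 4 ^ k * s" using that s by (intro mult_right_mono power_increasing) auto
    then show ?thesis using n by linarith
  qed
  have summand: "\<Psi> (4 ^ k * s) / sqrt (4 ^ k * s) * sqrt x \<le> \<Psi> x / sqrt x * (2 ^ k * sqrt s)" if "k \<le> n" for k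
  proof -
    define y where "y = 4 ^ k * s"
    have "0 < y" using s by (simp add: y_def)
    moreover have "y \<le> x" unfolding y_def using mono[OF that] n(1) by linarith
    ultimately have y: "0 < y" "y \<le> x" by auto
    have "\<Psi> y / y \<le> \<Psi> x / x" by (rule orlicz_div_mono[OF O y])
    then have "\<Psi> y / y * (sqrt y * sqrt x) \<le> \<Psi> x / x * (sqrt y * sqrt x)"
      using y by (intro mult_right_mono) auto
    moreover have "\<Psi> y / y * (sqrt y * sqrt x) = \<Psi> y / sqrt y * sqrt x"
      using y real_sqrt_mult_self[of y] by (simp add: field_simps)
    moreover have "\<Psi> x / x * (sqrt y * sqrt x) = \<Psi> x / sqrt x * sqrt y"
      using x0 real_sqrt_mult_self[of x] by (simp add: field_simps)
    ultimately show ?thesis by (simp add: y_def sq)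
  qed
  have "(\<Sum>k. ennreal (\<Psi> (4 ^ k * s) / sqrt (4 ^ k * s)) * (ennreal (sqrt x) * indicator {..<x} (4 ^ k * s)))
    = (\<Sum>k\<le>n. ennreal (\<Psi> (4 ^ k * s) / sqrt (4 ^ k * s)) * (ennreal (sqrt x) * indicator {..<x} (4 ^ k * s)))"
    by (rule suminf_finite) (use out in auto)
  also have "\<dots> \<le> (\<Sum>k\<le>n. ennreal (\<Psi> x / sqrt x * (2 ^ k * sqrt s)))"
  proof (rule sum_mono)
    fix k assume k: "k \<in> {..n}"
    have less: "4 ^ k * s < x" using mono[of k] k n(1) by (metis atMost_iff le_less_trans)
    have "0 \<le> \<Psi> (4 ^ k * s)" using s by (intro orlicz_nonneg[OF O]) auto
    then have "ennreal (\<Psi> (4 ^ k * s) / sqrt (4 ^ k * s)) * (ennreal (sqrt x) * indicator {..<x} (4 ^ k * s))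
      = ennreal (\<Psi> (4 ^ k * s) / sqrt (4 ^ k * s) * sqrt x)"
      using less s x by (subst ennreal_mult) (auto simp: indicator_def)
    then show "ennreal (\<Psi> (4 ^ k * s) / sqrt (4 ^ k * s)) * (ennreal (sqrt x) * indicator {..<x} (4 ^ k * s))
      \<le> ennreal (\<Psi> x / sqrt x * (2 ^ k * sqrt s))" using summand[of k] k by (auto intro: ennreal_leI)
  qed
  also have "\<dots> = ennreal (\<Sum>k\<le>n. \<Psi> x / sqrt x * (2 ^ k * sqrt s))"
    using s x0 orlicz_nonneg[OF O x] by (intro sum_ennreal) auto
  also have "\<dots> \<le> ennreal (2 * \<Psi> x)"
  proof (rule ennreal_leI)
    have geo: "(\<Sum>k\<le>n. (2::real) ^ k) = 2 ^ Suc n - 1" by (induction n) auto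
    have "(\<Sum>k\<le>n. \<Psi> x / sqrt x * (2 ^ k * sqrt s)) = \<Psi> x / sqrt x * ((2 ^ Suc n - 1) * sqrt s)"
      unfolding sum_distrib_left[symmetric] sum_distrib_right[symmetric] geo ..
    also have "\<dots> \<le> \<Psi> x / sqrt x * (2 * sqrt x)"
    proof (rule mult_left_mono)
      have "2 ^ n * sqrt s \<le> sqrt x" unfolding sq[symmetric] using n by simp
      moreover have "(2 ^ Suc n - 1) * sqrt s = 2 * (2 ^ n * sqrt s) - sqrt s" by (simp add: algebra_simps)
      moreover have "0 \<le> sqrt s" using s by simp
      ultimately show "(2 ^ Suc n - 1) * sqrt s \<le> 2 * sqrt x" by linarith
    qed (use x0 orlicz_nonneg[OF O x] in auto)
    also have "\<dots> = 2 * \<Psi> x" using x0 by simp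
    finally show "(\<Sum>k\<le>n. \<Psi> x / sqrt x * (2 ^ k * sqrt s)) \<le> 2 * \<Psi> x" .
  qed
  finally show ?thesis .
qed

text \<open>One term suffices: that of the last level 4096 * 4^n s below x, since x is at most 4
  times that level and 16384 = 4 * 4096. Small x are absorbed by the constant term.\<close>

lemma orlicz_le_level_sum:
  assumes O: "orlicz \<Psi>" and A: "0 < A" and s: "0 < s" and x: "0 \<le> x"
  shows "ennreal (\<Psi> (A / 16384 * x)) \<le> ennreal (\<Psi> (A * s)) +
    (\<Sum>k. ennreal (\<Psi> (A * (4 ^ k * s))) * indicator {..<x} (4096 * (4 ^ k * s)))"
proof (cases "4096 * s < x")
  case False
  then have "A / 16384 * x \<le> A / 16384 * (4096 * s)" using A by (intro mult_left_mono) auto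
  also have "\<dots> \<le> A * s" using A s by simp
  finally have "\<Psi> (A / 16384 * x) \<le> \<Psi> (A * s)" using A x by (intro orlicz_mono[OF O]) auto
  then show ?thesis by (intro add_increasing2 ennreal_leI) auto
next
  case True
  obtain n where n: "4 ^ n * (4096 * s) < x" "x \<le> 4 ^ Suc n * (4096 * s)"
    using least_power_scale[OF _ True] s by auto
  define f where "f = (\<lambda>k::nat. ennreal (\<Psi> (A * (4 ^ k * s))) * indicator {..<x} (4096 * (4 ^ k * s)))"
  have "A / 16384 * x \<le> A / 16384 * (4 ^ Suc n * (4096 * s))" using A n by (intro mult_left_mono) auto
  also have "\<dots> = A * (4 ^ n * s)" by simp
  finally have "\<Psi> (A / 16384 * x) \<le> \<Psi> (A * (4 ^ n * s))" using A x by (intro orlicz_mono[OF O]) auto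
  then have "ennreal (\<Psi> (A / 16384 * x)) \<le> f n"
    using n by (auto simp: f_def indicator_def algebra_simps intro: ennreal_leI)
  also have "f n \<le> suminf f" using sum_le_suminf[OF summableI, of "{n}" f] by simp
  finally show ?thesis unfolding f_def by (intro add_increasing) auto
qed


lemma borel_measurable_continuous_on_cball:
  fixes f :: "complex \<Rightarrow> complex"
  assumes sets: "sets \<mu> = sets (restrict_space borel (cball (0::complex) 1))"
    and f: "continuous_on (cball 0 1) f"
  shows "f \<in> borel_measurable \<mu>"
  using borel_measurable_continuous_on_restrict[OF f] measurable_cong_sets[OF sets refl] by blast

text \<open>The level sum is integrated against \<mu>, each level set is replaced by its bound on
  the circle, and the resulting sum is estimated pointwise by \<Psi>1 (|g|). The constant is 64 = 32
  * 2.\<close>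

lemma modular_estimate:
  fixes g :: "complex \<Rightarrow> complex"
  assumes fin: "finite_measure \<mu>"
    and sets: "sets \<mu> = sets (restrict_space borel (cball (0::complex) 1))"
    and O1: "orlicz \<Psi>1" and O2: "orlicz \<Psi>2" and A: "A > 0"
    and K: "\<And>h. h \<in> {0<..1} \<Longrightarrow> K_mu \<mu> h \<le> ereal ((1 / h) / \<Psi>2 (A * orlicz_inv \<Psi>1 (1 / h)))"
    and cont: "continuous_on (cball 0 1) g"
    and sub: "\<And>z. norm z < 1 \<Longrightarrow> ennreal (sqrt (norm (g z))) \<le>
      (\<integral>\<^sup>+\<theta>. ennreal (sqrt (norm (g (cis \<theta>))) * poisson_kernel z (cis \<theta>)) \<partial>circle_measure)"
    and int: "(\<integral>\<^sup>+\<theta>. ennreal (\<Psi>1 (norm (g (cis \<theta>)))) \<partial>circle_measure) \<le> 1"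
  shows "(\<integral>\<^sup>+z. ennreal (\<Psi>2 (A / 16384 * norm (g z))) \<partial>\<mu>) \<le>
    ennreal (\<Psi>2 (A * orlicz_inv \<Psi>1 1) * measure \<mu> (space \<mu>) + 64)"
proof -
  interpret finite_measure \<mu> by (rule fin)
  \<comment> \<open>Since \<Psi>1 s = 1, each level \<sigma> k \<ge> s gives a scale 1 / \<Psi>1
    (\<sigma> k) in (0, 1], where the hypothesis speaks; smaller values of |g| are paid for by the
    finite mass of \<mu>.\<close>
  define s where "s = orlicz_inv \<Psi>1 1"
  have s: "0 < s" "\<Psi>1 s = 1" using orlicz_inv_pos[OF O1] orlicz_orlicz_inv[OF O1] by (auto simp: s_def)
  define \<sigma> where "\<sigma> k = 4 ^ k * s" for k :: nat
  have sig: "0 < \<sigma> k" "s \<le> \<sigma> k" for k using s by (auto simp: \<sigma>_def)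
  have P1: "1 \<le> \<Psi>1 (\<sigma> k)" for k using orlicz_mono[OF O1, of s "\<sigma> k"] s sig[of k] by simp
  have P2: "0 < \<Psi>2 (A * \<sigma> k)" for k using A sig by (intro orlicz_pos[OF O2]) auto
  define E where "E k = {z\<in>cball 0 1. 4096 * \<sigma> k < norm (g z)}" for k
  have space: "space \<mu> = cball 0 1" using sets_eq_imp_space_eq[OF sets] by (simp add: space_restrict_space)
  have gm [measurable]: "g \<in> borel_measurable \<mu>" by (rule borel_measurable_continuous_on_cball[OF sets cont])
  have E [measurable]: "E k \<in> sets \<mu>" for k
  proof -
    have "{z\<in>space \<mu>. 4096 * \<sigma> k < norm (g z)} \<in> sets \<mu>" by measurable
    then show ?thesis by (simp add: E_def space)
  qed
  define T where "T k = (\<integral>\<^sup>+\<theta>. trunc_sqrt g (\<sigma> k) \<theta> \<partial>circle_measure)" for k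
  have level: "emeasure \<mu> (E k) \<le> ennreal (32 * (\<Psi>1 (\<sigma> k) / \<Psi>2 (A * \<sigma> k)) / sqrt (\<sigma> k)) * T k" for k
    unfolding E_def T_def by (rule level_set_measure_le[OF fin sets O1 O2 A K cont sub int sig(1) P1])
  have "(\<integral>\<^sup>+z. ennreal (\<Psi>2 (A / 16384 * norm (g z))) \<partial>\<mu>) \<le>
    (\<integral>\<^sup>+z. ennreal (\<Psi>2 (A * s)) + (\<Sum>k. ennreal (\<Psi>2 (A * \<sigma> k)) * indicator (E k) z) \<partial>\<mu>)"
  proof (rule nn_integral_mono)
    fix z assume z: "z \<in> space \<mu>"
    have "ennreal (\<Psi>2 (A / 16384 * norm (g z))) \<le> ennreal (\<Psi>2 (A * s)) +
      (\<Sum>k. ennreal (\<Psi>2 (A * (4 ^ k * s))) * indicator {..<norm (g z)} (4096 * (4 ^ k * s)))"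
      by (rule orlicz_le_level_sum[OF O2 A s(1)]) simp
    also have "(\<Sum>k. ennreal (\<Psi>2 (A * (4 ^ k * s))) * indicator {..<norm (g z)} (4096 * (4 ^ k * s)))
        = (\<Sum>k. ennreal (\<Psi>2 (A * \<sigma> k)) * indicator (E k) z)"
      by (rule suminf_cong) (use z in \<open>auto simp: space E_def \<sigma>_def indicator_def\<close>)
    finally show "ennreal (\<Psi>2 (A / 16384 * norm (g z))) \<le> ennreal (\<Psi>2 (A * s)) +
      (\<Sum>k. ennreal (\<Psi>2 (A * \<sigma> k)) * indicator (E k) z)" .
  qed
  also have "\<dots> = ennreal (\<Psi>2 (A * s)) * emeasure \<mu> (space \<mu>) +
      (\<Sum>k. ennreal (\<Psi>2 (A * \<sigma> k)) * emeasure \<mu> (E k))"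
    by (simp add: nn_integral_add nn_integral_suminf nn_integral_cmult_indicator)
  also have "\<dots> \<le> ennreal (\<Psi>2 (A * s) * measure \<mu> (space \<mu>)) + ennreal 64"
  proof (rule add_mono)
    show "ennreal (\<Psi>2 (A * s)) * emeasure \<mu> (space \<mu>) \<le> ennreal (\<Psi>2 (A * s) * measure \<mu> (space \<mu>))"
      using orlicz_nonneg[OF O2, of "A * s"] A s by (simp add: emeasure_eq_measure ennreal_mult)
    have "(\<Sum>k. ennreal (\<Psi>2 (A * \<sigma> k)) * emeasure \<mu> (E k)) \<le>
        (\<Sum>k. ennreal 32 * (ennreal (\<Psi>1 (\<sigma> k) / sqrt (\<sigma> k)) * T k))"
    proof (intro suminf_le summableI)
      fix k
      have "ennreal (\<Psi>2 (A * \<sigma> k)) * emeasure \<mu> (E k) \<le>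
          ennreal (\<Psi>2 (A * \<sigma> k)) * (ennreal (32 * (\<Psi>1 (\<sigma> k) / \<Psi>2 (A * \<sigma> k)) / sqrt (\<sigma> k)) * T k)"
        by (intro mult_left_mono level) auto
      also have "\<dots> = ennreal (\<Psi>2 (A * \<sigma> k) * (32 * (\<Psi>1 (\<sigma> k) / \<Psi>2 (A * \<sigma> k)) / sqrt (\<sigma> k))) * T k"
        using P1[of k] P2[of k] sig[of k] by (subst ennreal_mult) (auto simp: mult.assoc)
      also have "\<Psi>2 (A * \<sigma> k) * (32 * (\<Psi>1 (\<sigma> k) / \<Psi>2 (A * \<sigma> k)) / sqrt (\<sigma> k)) = 32 * (\<Psi>1 (\<sigma> k) / sqrt (\<sigma> k))"
        using P2[of k] by simp
      also have "ennreal \<dots> = ennreal 32 * ennreal (\<Psi>1 (\<sigma> k) / sqrt (\<sigma> k))"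
        using P1[of k] sig[of k] by (intro ennreal_mult) auto
      finally show "ennreal (\<Psi>2 (A * \<sigma> k)) * emeasure \<mu> (E k) \<le>
          ennreal 32 * (ennreal (\<Psi>1 (\<sigma> k) / sqrt (\<sigma> k)) * T k)" by (simp only: mult.assoc)
    qed
    also have "\<dots> = ennreal 32 * (\<Sum>k. ennreal (\<Psi>1 (\<sigma> k) / sqrt (\<sigma> k)) * T k)"
      by (simp only: ennreal_suminf_cmult)
    \<comment> \<open>Sum and integral are exchanged so that the levels can be summed at each
      \<theta>.\<close>
    also have "(\<Sum>k. ennreal (\<Psi>1 (\<sigma> k) / sqrt (\<sigma> k)) * T k)
        = (\<integral>\<^sup>+\<theta>. (\<Sum>k. ennreal (\<Psi>1 (\<sigma> k) / sqrt (\<sigma> k)) * trunc_sqrt g (\<sigma> k) \<theta>) \<partial>circle_measure)"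
    proof -
      have [measurable]: "trunc_sqrt g (\<sigma> k) \<in> borel_measurable circle_measure" for k
        by (intro measurable_circle_measureI borel_measurable_trunc_sqrt cont)
      show ?thesis unfolding T_def
        by (subst nn_integral_suminf) (auto intro!: suminf_cong nn_integral_cmult[symmetric])
    qed
    also have "\<dots> \<le> (\<integral>\<^sup>+\<theta>. ennreal 2 * ennreal (\<Psi>1 (norm (g (cis \<theta>)))) \<partial>circle_measure)"
    proof (rule nn_integral_mono)
      fix \<theta>
      have "(\<Sum>k. ennreal (\<Psi>1 (\<sigma> k) / sqrt (\<sigma> k)) * trunc_sqrt g (\<sigma> k) \<theta>)
         = (\<Sum>k. ennreal (\<Psi>1 (4 ^ k * s) / sqrt (4 ^ k * s)) *
            (ennreal (sqrt (norm (g (cis \<theta>)))) * indicator {..<norm (g (cis \<theta>))} (4 ^ k * s)))"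
        by (intro suminf_cong) (auto simp: trunc_sqrt_def \<sigma>_def indicator_def)
      also have "\<dots> \<le> ennreal (2 * \<Psi>1 (norm (g (cis \<theta>))))" by (rule trunc_sqrt_sum_le[OF O1 s(1)]) simp
      also have "\<dots> = ennreal 2 * ennreal (\<Psi>1 (norm (g (cis \<theta>))))"
        by (intro ennreal_mult orlicz_nonneg[OF O1]) auto
      finally show "(\<Sum>k. ennreal (\<Psi>1 (\<sigma> k) / sqrt (\<sigma> k)) * trunc_sqrt g (\<sigma> k) \<theta>)
        \<le> ennreal 2 * ennreal (\<Psi>1 (norm (g (cis \<theta>))))" .
    qed
    also have "\<dots> = ennreal 2 * (\<integral>\<^sup>+\<theta>. ennreal (\<Psi>1 (norm (g (cis \<theta>)))) \<partial>circle_measure)"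
    proof (rule nn_integral_cmult)
      have "(\<lambda>\<theta>. norm (g (cis \<theta>))) \<in> borel_measurable circle_measure"
        by (intro measurable_circle_measureI
            measurable_compose[OF borel_measurable_cis_compose[OF cont] borel_measurable_norm])
      from borel_measurable_orlicz[OF O1 this]
      show "(\<lambda>\<theta>. ennreal (\<Psi>1 (norm (g (cis \<theta>))))) \<in> borel_measurable circle_measure" by simp
    qed
    also have "\<dots> \<le> ennreal 2 * 1" by (intro mult_left_mono int) auto
    finally have "(\<Sum>k. ennreal (\<Psi>2 (A * \<sigma> k)) * emeasure \<mu> (E k)) \<le> ennreal 32 * (ennreal 2 * 1)"
      by (simp add: mult_left_mono)
    also have "\<dots> = ennreal 64" by (simp flip: ennreal_mult)
    finally show "(\<Sum>k. ennreal (\<Psi>2 (A * \<sigma> k)) * emeasure \<mu> (E k)) \<le> ennreal 64" .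
  qed
  also have "\<dots> = ennreal (\<Psi>2 (A * s) * measure \<mu> (space \<mu>) + 64)"
    using orlicz_nonneg[OF O2, of "A * s"] A s by (intro ennreal_plus[symmetric]) auto
  finally show ?thesis by (simp add: s_def)
qed

section \<open>Radial limits and the embedding\<close>

text \<open>For fixed \<open>\<epsilon>\<close> and \<open>k\<close> the set of points whose radial oscillation beyond \<open>1 - 1/(k+1)\<close> is at most \<open>\<epsilon>\<close>
  is closed, being an intersection of closed sets; so the radial limits exist on a Borel set.\<close>

lemma radial_limit_set:
  fixes f :: "complex \<Rightarrow> complex"
  assumes f: "continuous_on (ball 0 1) f"
  defines "G \<equiv> (\<Inter>m. \<Union>k. {z\<in>cball 0 1. \<forall>r\<in>{1 - 1/Suc k<..<1}. \<forall>s\<in>{1 - 1/Suc k<..<1}.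
      dist (f (of_real r * z)) (f (of_real s * z)) \<le> (1 / Suc m :: real)})"
  shows "G \<in> sets borel"
    and "\<And>z. norm z \<le> 1 \<Longrightarrow> z \<in> G \<longleftrightarrow> (\<exists>l. ((\<lambda>r::real. f (of_real r * z)) \<longlongrightarrow> l) (at_left 1))"
proof -
  define S where "S e k = {z\<in>cball 0 1. \<forall>r\<in>{1 - 1/Suc k<..<1}. \<forall>s\<in>{1 - 1/Suc k<..<1}.
      dist (f (of_real r * z)) (f (of_real s * z)) \<le> e}" for e :: real and k :: nat
  have G: "G = (\<Inter>m. \<Union>k. S (1 / Suc m) k)" by (simp only: G_def S_def)
  have "closed (S e k)" for e k
  proof -
    let ?I = "{1 - 1/Suc k<..<1} :: real set"
    have "S e k = cball 0 1 \<inter> (\<Inter>r\<in>?I. \<Inter>s\<in>?I. {z\<in>cball 0 1. dist (f (of_real r * z)) (f (of_real s * z)) \<le> e})"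
      unfolding S_def by blast
    moreover have I: "0 \<le> t" if "t \<in> ?I" for t
    proof -
      have "1 / Suc k \<le> (1::real)" by simp
      then show ?thesis using that by (simp only: greaterThanLessThan_iff) linarith
    qed
    moreover have "closed {z\<in>cball 0 1. dist (f (of_real r * z)) (f (of_real s * z)) \<le> e}"
      if "r \<in> ?I" "s \<in> ?I" for r s
    proof -
      have "norm (of_real t * z) < 1" if "t \<in> ?I" "norm z \<le> 1" for t and z :: complex
      proof -
        have "t * norm z \<le> t * 1" using that I[of t] by (intro mult_left_mono) auto
        then show ?thesis using that I[of t] by (auto simp: norm_mult simp del: of_nat_Suc)
      qed
      then have "continuous_on (cball 0 1) (\<lambda>z. f (of_real t * z))" if "t \<in> ?I" for t
        using that by (intro continuous_on_compose2[OF f] continuous_intros) auto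
      then have "continuous_on (cball 0 1) (\<lambda>z. dist (f (of_real r * z)) (f (of_real s * z)))"
        using that by (intro continuous_intros) auto
      then have "closed (cball 0 1 \<inter> (\<lambda>z. dist (f (of_real r * z)) (f (of_real s * z))) -` {..e})"
        by (intro continuous_closed_preimage) auto
      moreover have "{z\<in>cball 0 1. dist (f (of_real r * z)) (f (of_real s * z)) \<le> e} =
          cball 0 1 \<inter> (\<lambda>z. dist (f (of_real r * z)) (f (of_real s * z))) -` {..e}" by auto
      ultimately show ?thesis by simp
    qed
    ultimately show ?thesis by (simp only:) (intro closed_Int closed_cball closed_INT ballI)
  qed
  then show "G \<in> sets borel"
    unfolding G by (intro sets.countable_INT'' sets.countable_UN'' borel_closed) auto
  show "z \<in> G \<longleftrightarrow> (\<exists>l. ((\<lambda>r::real. f (of_real r * z)) \<longlongrightarrow> l) (at_left 1))" if z: "norm z \<le> 1" for z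
  proof -
    \<comment> \<open>Completeness turns existence of the limit into a Cauchy property, which does
      not mention the limit and reduces to countably many conditions.\<close>
    let ?F = "filtermap (\<lambda>r::real. f (of_real r * z)) (at_left 1)"
    have nb: "?F \<noteq> bot" by (simp add: filtermap_bot_iff)
    have iff: "cauchy_filter ?F \<longleftrightarrow> (\<exists>l. ((\<lambda>r::real. f (of_real r * z)) \<longlongrightarrow> l) (at_left 1))"
      using cauchy_filter_complete_converges[OF _ complete_UNIV, of ?F] nb nhds_imp_cauchy_filter[of ?F]
      by (auto simp: filterlim_def)
    have "z \<in> G \<longleftrightarrow> cauchy_filter ?F"
      unfolding cauchy_filter_metric_filtermap
    proof (intro iffI allI impI)
      fix e :: real assume zG: "z \<in> G" and e: "e > 0"
      obtain m where m: "1 / Suc m < e" using nat_approx_posE[OF e] by metis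
      have "z \<in> (\<Union>k. S (1 / Suc m) k)" using zG unfolding G by (rule INT_D[OF _ UNIV_I])
      then obtain k where "z \<in> S (1 / Suc m) k" by (rule UN_E)
      then have k: "dist (f (of_real r * z)) (f (of_real s * z)) < e"
        if "r \<in> {1 - 1/Suc k<..<1}" "s \<in> {1 - 1/Suc k<..<1}" for r s
        unfolding S_def using that m by (smt (verit) mem_Collect_eq)
      have "\<forall>\<^sub>F r in at_left 1. r \<in> {1 - 1/Suc k<..<1::real}"
        by (rule eventually_at_leftI[of "1 - 1/Suc k"]) simp_all
      then show "\<exists>P. eventually P (at_left 1) \<and>
          (\<forall>x y. P x \<and> P y \<longrightarrow> dist (f (of_real x * z)) (f (of_real y * z)) < e)"
        using k by (intro exI[of _ "\<lambda>r. r \<in> {1 - 1/Suc k<..<1::real}"]) blast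
    next
      assume *: "\<forall>e>0. \<exists>P. eventually P (at_left 1) \<and>
          (\<forall>x y. P x \<and> P y \<longrightarrow> dist (f (of_real x * z)) (f (of_real y * z)) < e)"
      have "\<exists>k. z \<in> S (1 / Suc m) k" for m :: nat
      proof -
        have "0 < 1 / real (Suc m)" by simp
        then obtain P where P: "eventually P (at_left (1::real))"
          "\<And>x y. P x \<Longrightarrow> P y \<Longrightarrow> dist (f (of_real x * z)) (f (of_real y * z)) < 1 / Suc m"
          using * by meson
        then obtain b where b: "b < 1" "\<And>y. b < y \<Longrightarrow> y < 1 \<Longrightarrow> P y"
          by (auto simp: eventually_at_left_field)
        have "1 - b > 0" using b by simp
        then obtain k where k: "1 / Suc k < 1 - b" by (rule nat_approx_posE)
        have "P r" if "r \<in> {1 - 1/Suc k<..<1}" for r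
        proof (rule b(2))
          show "b < r" "r < 1" using that k by (simp_all only: greaterThanLessThan_iff) linarith
        qed
        then have "z \<in> S (1 / Suc m) k" unfolding S_def using P(2) z by (auto intro: less_imp_le)
        then show ?thesis ..
      qed
      then show "z \<in> G" unfolding G by blast
    qed
    then show ?thesis using iff by simp
  qed
qed

text \<open>On the Borel set of radial convergence the extension is a limit along one sequence of
  radii, hence of continuous functions; elsewhere it is 0. The case split stays explicit because the
  sequential limit may exist where the radial one does not.\<close>

lemma disc_ext_measurable:
  assumes sets: "sets \<mu> = sets (restrict_space borel (cball (0::complex) 1))"
    and f: "continuous_on (ball 0 1) f"
  shows "disc_ext f \<in> borel_measurable \<mu>"
proof -
  obtain G where G: "G \<in> sets borel"
    "\<And>z. norm z \<le> 1 \<Longrightarrow> z \<in> G \<longleftrightarrow> (\<exists>l. ((\<lambda>r::real. f (of_real r * z)) \<longlongrightarrow> l) (at_left 1))"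
    using radial_limit_set[OF f] by blast
  have space: "space \<mu> = cball 0 1" using sets_eq_imp_space_eq[OF sets] by (simp add: space_restrict_space)
  define t :: "nat \<Rightarrow> real" where "t n = 1 - 1 / Suc n" for n
  have t: "0 \<le> t n" "t n < 1" for n by (auto simp: t_def)
  have "t \<longlonglongrightarrow> 1 - 0" unfolding t_def[abs_def]
    by (intro tendsto_intros) (rule LIMSEQ_Suc[OF lim_1_over_n])
  then have tl: "filterlim t (at_left 1) sequentially"
    using t less_imp_neq[OF t(2)] by (auto simp: filterlim_at)
  have m: "(\<lambda>z. f (of_real (t n) * z)) \<in> borel_measurable \<mu>" for n
  proof (intro borel_measurable_continuous_on_cball[OF sets] continuous_on_compose2[OF f] continuous_intros)
    show "(*) (of_real (t n)) ` cball 0 1 \<subseteq> ball (0::complex) 1"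
    proof
      fix w :: complex assume "w \<in> (*) (of_real (t n)) ` cball 0 (1::real)"
      then obtain z where "w = of_real (t n) * z" "z \<in> cball 0 1" by blast
      then have z: "w = of_real (t n) * z" "norm z \<le> 1" by auto
      have "t n * norm z \<le> t n * 1" using z t by (intro mult_left_mono) auto
      then show "w \<in> ball 0 1" using t[of n] z by (auto simp: norm_mult)
    qed
  qed
  have "(\<lambda>z. if z \<in> G then lim (\<lambda>n. f (of_real (t n) * z)) else 0) \<in> borel_measurable \<mu>"
  proof (rule measurable_If_set)
    show "(\<lambda>z. lim (\<lambda>n. f (of_real (t n) * z))) \<in> borel_measurable \<mu>"
      by (rule borel_measurable_lim_metric[OF m])
    show "G \<inter> space \<mu> \<in> sets \<mu>" using G(1) by (auto simp: sets space sets_restrict_space)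
  qed simp
  moreover have "disc_ext f z = (if z \<in> G then lim (\<lambda>n. f (of_real (t n) * z)) else 0)" if zs: "z \<in> space \<mu>" for z
  proof (cases "z \<in> G")
    case True
    then obtain l where l: "((\<lambda>r::real. f (of_real r * z)) \<longlongrightarrow> l) (at_left 1)" using G(2) zs by (auto simp: space)
    have "(\<lambda>n. f (of_real (t n) * z)) \<longlonglongrightarrow> l" by (rule filterlim_compose[OF l tl])
    then show ?thesis using True l by (simp add: disc_ext_eq_boundary_fun[OF f] boundary_fun_eq limI)
  next
    case False
    then show ?thesis using G(2) zs by (auto simp: space disc_ext_eq_boundary_fun[OF f] boundary_fun_def)
  qed
  ultimately show ?thesis by (subst measurable_cong) auto
qed

text \<open>A nonconstant holomorphic function has finitely many zeros in each smaller closed disc,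
  so all but finitely many radii in an interval (a, b) with b < 1 avoid their moduli.\<close>

lemma good_radii:
  assumes f: "f holomorphic_on ball (0::complex) 1"
  obtains s :: "nat \<Rightarrow> real" where "filterlim s (at_left 1) sequentially" "\<And>n. 0 < s n \<and> s n < 1"
    "\<And>n. f constant_on ball 0 1 \<or> (\<forall>z\<in>sphere 0 1. f (of_real (s n) * z) \<noteq> 0)"
proof -
  have ex: "\<exists>s. 1 - 1 / Suc n < s \<and> s < 1 \<and> (f constant_on ball 0 1 \<or> (\<forall>z\<in>sphere 0 1. f (of_real s * z) \<noteq> 0))" for n :: nat
  proof -
    define a where "a = 1 - 1 / real (Suc n)"
    obtain b where b: "a < b" "b < 1" using dense[of a 1] by (auto simp: a_def)
    show ?thesis
    proof (cases "f constant_on ball 0 1")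
      case True
      then show ?thesis using b by (intro exI[of _ b]) (auto simp: a_def)
    next
      case False
      then have "finite {z\<in>cball 0 b. f z = 0}"
        by (intro holomorphic_compact_finite_zeros[OF f]) (use b in auto)
      then have "finite (norm ` {z\<in>cball 0 b. f z = 0})" by (rule finite_imageI)
      moreover have "infinite {a<..<b}" using b by (simp add: infinite_Ioo)
      ultimately have "{a<..<b} - norm ` {z\<in>cball 0 b. f z = 0} \<noteq> {}"
        using Diff_infinite_finite finite.emptyI by metis
      then obtain s where s: "s \<in> {a<..<b}" "s \<notin> norm ` {z\<in>cball 0 b. f z = 0}" by blast
      have "0 \<le> a" by (simp add: a_def)
      then have s0: "0 < s" using s by auto
      have "f (of_real s * z) \<noteq> 0" if "z \<in> sphere 0 1" for z
      proof
        assume "f (of_real s * z) = 0"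
        moreover have "norm (of_real s * z) = s" using that s0 by (simp add: norm_mult)
        ultimately have "of_real s * z \<in> {z\<in>cball 0 b. f z = 0}" using s by auto
        then show False using s(2) \<open>norm (of_real s * z) = s\<close> by (metis imageI)
      qed
      then show ?thesis using s b by (intro exI[of _ s]) (auto simp: a_def)
    qed
  qed
  then obtain s where s: "\<And>n. 1 - 1 / Suc n < s n" "\<And>n. s n < 1"
    "\<And>n. f constant_on ball 0 1 \<or> (\<forall>z\<in>sphere 0 1. f (of_real (s n) * z) \<noteq> 0)" by metis
  have "0 < s n" for n
  proof -
    have "0 \<le> 1 - 1 / real (Suc n)" by simp
    then show ?thesis using s(1)[of n] by linarith
  qed
  moreover have "(\<lambda>n. 1 - 1 / real (Suc n)) \<longlonglongrightarrow> 1 - 0"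
    by (intro tendsto_intros) (rule LIMSEQ_Suc[OF lim_1_over_n])
  then have "s \<longlonglongrightarrow> 1"
    by (intro tendsto_sandwich[of "\<lambda>n. 1 - 1 / real (Suc n)" s sequentially "\<lambda>_. 1" 1])
      (use s in \<open>auto intro!: always_eventually less_imp_le simp del: of_nat_Suc\<close>)
  then have "filterlim s (at_left 1) sequentially" using s(2) less_imp_neq[OF s(2)] by (auto simp: filterlim_at)
  ultimately show ?thesis using that[of s] s by blast
qed

text \<open>The modular estimate gives a bound B \<ge> 1 instead of 1. Convexity absorbs it through
  \<Psi>2 (x / B) \<le> \<Psi>2 x / B, which explains D = 16384 B / A.\<close>

lemma hardy_orlicz_embeds_of_K_mu:
  assumes fin: "finite_measure \<mu>"
    and sets: "sets \<mu> = sets (restrict_space borel (cball (0::complex) 1))"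
    and O1: "orlicz \<Psi>1" and O2: "orlicz \<Psi>2" and A: "A > 0"
    and K: "\<And>h. h \<in> {0<..1} \<Longrightarrow> K_mu \<mu> h \<le> ereal ((1 / h) / \<Psi>2 (A * orlicz_inv \<Psi>1 (1 / h)))"
  shows "hardy_orlicz_embeds \<Psi>1 \<Psi>2 \<mu>"
proof -
  define B where "B = \<Psi>2 (A * orlicz_inv \<Psi>1 1) * measure \<mu> (space \<mu>) + 64"
  have B: "1 \<le> B"
    using orlicz_nonneg[OF O2, of "A * orlicz_inv \<Psi>1 1"] orlicz_inv_nonneg[OF O1, of 1] A by (simp add: B_def)
  define D where "D = 16384 * B / A"
  have D: "D > 0" using A B by (simp add: D_def)
  have space: "space \<mu> = cball 0 1" using sets_eq_imp_space_eq[OF sets] by (simp add: space_restrict_space)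
  have main: "(\<integral>\<^sup>+z. ennreal (\<Psi>2 (norm (disc_ext f z) / (C * D))) \<partial>\<mu>) \<le> 1"
    if f: "in_hardy_orlicz \<Psi>1 f" and C: "C > 0" "hardy_norm \<Psi>1 f < C" for f C
  proof -
    have hol: "f holomorphic_on ball 0 1" using f by (simp add: in_hardy_orlicz_def)
    then have cf: "continuous_on (ball 0 1) f" by (rule holomorphic_on_imp_continuous_on)
    obtain s where s: "filterlim s (at_left 1) sequentially" "\<And>n. 0 < s n \<and> s n < 1"
      "\<And>n. f constant_on ball 0 1 \<or> (\<forall>z\<in>sphere 0 1. f (of_real (s n) * z) \<noteq> 0)"
      by (rule good_radii[OF hol]) (rule that)
    \<comment> \<open>Dilates are holomorphic on a disc of radius 1 / s n > 1, and division by C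
      brings their circle modular below 1.\<close>
    define g where "g n z = f (of_real (s n) * z) / of_real C" for n z
    have sub: "of_real (s n) * z \<in> ball 0 1" if "z \<in> ball 0 (1 / s n)" for n and z :: complex
      using that s(2)[of n] by (simp add: norm_mult field_simps)
    have gh: "g n holomorphic_on ball 0 (1 / s n)" for n
      unfolding g_def using sub C
      by (intro holomorphic_intros holomorphic_on_compose_gen[OF _ hol, unfolded o_def]) auto
    have s1: "1 < 1 / s n" for n using s(2)[of n] by simp
    have gc: "continuous_on (cball 0 1) (g n)" for n
      by (rule continuous_on_subset[OF holomorphic_on_imp_continuous_on[OF gh]]) (use s1[of n] in auto)
    have gz: "g n constant_on ball 0 (1 / s n) \<or> (\<forall>z\<in>sphere 0 1. g n z \<noteq> 0)" for n
      using s(3)[of n] sub[of _ n] C unfolding g_def constant_on_def by (metis divide_eq_0_iff less_irrefl of_real_eq_0_iff)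
    have gint: "(\<integral>\<^sup>+\<theta>. ennreal (\<Psi>1 (norm (g n (cis \<theta>)))) \<partial>circle_measure) \<le> 1" for n
    proof -
      have sn: "s n \<in> {0..<1}" using s(2)[of n] by auto
      have "lux_norm \<Psi>1 circle_measure (\<lambda>\<theta>. f (of_real (s n) * cis \<theta>)) \<le> hardy_norm \<Psi>1 f"
        unfolding hardy_norm_def by (rule cSUP_upper[OF sn]) (use f in \<open>simp add: in_hardy_orlicz_def\<close>)
      also note C(2)
      finally have "(\<integral>\<^sup>+\<theta>. ennreal (\<Psi>1 (norm (f (of_real (s n) * cis \<theta>)) / C)) \<partial>circle_measure) \<le> 1"
        using f sn by (intro nn_integral_le_1_of_lux_norm_less[OF O1]) (auto simp: in_hardy_orlicz_def)
      then show ?thesis using C by (simp add: g_def norm_divide)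
    qed
    define F where "F n z = ennreal (\<Psi>2 (norm (f (of_real (s n) * z)) / (C * D)))" for n z
    have Fint: "(\<integral>\<^sup>+z. F n z \<partial>\<mu>) \<le> 1" for n
    proof -
      have "(\<integral>\<^sup>+z. F n z \<partial>\<mu>) \<le> (\<integral>\<^sup>+z. ennreal (1 / B) * ennreal (\<Psi>2 (A / 16384 * norm (g n z))) \<partial>\<mu>)"
      proof (rule nn_integral_mono)
        fix z
        have "norm (f (of_real (s n) * z)) / (C * D) = 1 / B * (A / 16384 * norm (g n z))"
          using C A B by (simp add: g_def D_def norm_divide field_simps)
        also have "\<Psi>2 \<dots> \<le> 1 / B * \<Psi>2 (A / 16384 * norm (g n z))"
          using B A by (intro orlicz_scale[OF O2]) auto
        finally have "F n z \<le> ennreal (1 / B * \<Psi>2 (A / 16384 * norm (g n z)))"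
          unfolding F_def by (intro ennreal_leI) simp
        also have "\<dots> = ennreal (1 / B) * ennreal (\<Psi>2 (A / 16384 * norm (g n z)))"
          using B A by (intro ennreal_mult orlicz_nonneg[OF O2]) auto
        finally show "F n z \<le> ennreal (1 / B) * ennreal (\<Psi>2 (A / 16384 * norm (g n z)))" .
      qed
      also have "\<dots> = ennreal (1 / B) * (\<integral>\<^sup>+z. ennreal (\<Psi>2 (A / 16384 * norm (g n z))) \<partial>\<mu>)"
      proof (rule nn_integral_cmult)
        have [measurable]: "g n \<in> borel_measurable \<mu>" by (rule borel_measurable_continuous_on_cball[OF sets gc])
        have "(\<lambda>z. \<Psi>2 (A / 16384 * norm (g n z))) \<in> borel_measurable \<mu>"
          by (rule borel_measurable_orlicz[OF O2]) (use A in auto)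
        then show "(\<lambda>z. ennreal (\<Psi>2 (A / 16384 * norm (g n z)))) \<in> borel_measurable \<mu>" by simp
      qed
      also have "\<dots> \<le> ennreal (1 / B) * ennreal B"
        unfolding B_def
        by (intro mult_left_mono modular_estimate[OF fin sets O1 O2 A K gc _ gint]
            sqrt_norm_le_poisson[OF gh s1 gz]) auto
      also have "\<dots> = 1" using B by (subst ennreal_mult[symmetric]) auto
      finally show ?thesis .
    qed
    have Fm: "F n \<in> borel_measurable \<mu>" for n
    proof -
      have eq: "(\<lambda>z. f (of_real (s n) * z)) = (\<lambda>z. of_real C * g n z)" using C by (simp add: g_def)
      have "continuous_on (cball 0 1) (\<lambda>z. f (of_real (s n) * z))"
        unfolding eq by (intro continuous_intros gc)
      from borel_measurable_continuous_on_cball[OF sets this]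
      have "(\<lambda>z. norm (f (of_real (s n) * z)) / (C * D)) \<in> borel_measurable \<mu>" by measurable
      then have "(\<lambda>z. \<Psi>2 (norm (f (of_real (s n) * z)) / (C * D))) \<in> borel_measurable \<mu>"
        using C D by (intro borel_measurable_orlicz[OF O2]) auto
      then show ?thesis unfolding F_def[abs_def] by simp
    qed
    \<comment> \<open>Where the radial limit exists this is an equality by continuity of \<Psi>2;
      elsewhere the left side is 0.\<close>
    have "ennreal (\<Psi>2 (norm (disc_ext f z) / (C * D))) \<le> liminf (\<lambda>n. F n z)" for z
    proof (cases "\<exists>l. ((\<lambda>r::real. f (of_real r * z)) \<longlongrightarrow> l) (at_left 1)")
      case True
      then obtain l where l: "((\<lambda>r::real. f (of_real r * z)) \<longlongrightarrow> l) (at_left 1)" by blast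
      have dl: "disc_ext f z = l" using l by (simp add: disc_ext_eq_boundary_fun[OF cf] boundary_fun_eq)
      have "(\<lambda>n. f (of_real (s n) * z)) \<longlonglongrightarrow> l" by (rule filterlim_compose[OF l s(1)])
      then have "(\<lambda>n. norm (f (of_real (s n) * z)) / (C * D)) \<longlonglongrightarrow> norm l / (C * D)"
        using C D by (intro tendsto_intros) auto
      moreover have "isCont (\<lambda>x. \<Psi>2 (max 0 x)) (norm l / (C * D))"
        using continuous_on_orlicz_max[OF O2] by (simp add: continuous_on_eq_continuous_at)
      ultimately have "(\<lambda>n. \<Psi>2 (max 0 (norm (f (of_real (s n) * z)) / (C * D)))) \<longlonglongrightarrow> \<Psi>2 (max 0 (norm l / (C * D)))"
        by (rule isCont_tendsto_compose[rotated])
      then have "(\<lambda>n. F n z) \<longlonglongrightarrow> ennreal (\<Psi>2 (norm l / (C * D)))"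
        unfolding F_def using C D by (intro tendsto_ennrealI) (simp add: max_absorb2)
      then have "liminf (\<lambda>n. F n z) = ennreal (\<Psi>2 (norm l / (C * D)))"
        by (intro lim_imp_Liminf) auto
      then show ?thesis by (simp add: dl)
    next
      case False
      then show ?thesis by (simp add: disc_ext_eq_boundary_fun[OF cf] boundary_fun_def orlicz_zero[OF O2])
    qed
    then have "(\<integral>\<^sup>+z. ennreal (\<Psi>2 (norm (disc_ext f z) / (C * D))) \<partial>\<mu>) \<le> (\<integral>\<^sup>+z. liminf (\<lambda>n. F n z) \<partial>\<mu>)"
      by (intro nn_integral_mono)
    also have "\<dots> \<le> liminf (\<lambda>n. \<integral>\<^sup>+z. F n z \<partial>\<mu>)" by (rule nn_integral_liminf[OF Fm])
    also have "\<dots> \<le> liminf (\<lambda>n. 1)" by (intro Liminf_mono always_eventually allI Fint)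
    also have "\<dots> = 1" by (simp add: Liminf_const)
    finally show ?thesis .
  qed
  have nonneg: "0 \<le> hardy_norm \<Psi>1 f" if f: "in_hardy_orlicz \<Psi>1 f" for f
    by (rule hardy_norm_nonneg[OF f])
  show ?thesis
    unfolding hardy_orlicz_embeds_def
  proof (intro conjI allI impI exI[of _ D])
    fix f assume f: "in_hardy_orlicz \<Psi>1 f"
    then have "continuous_on (ball 0 1) f"
      by (auto simp: in_hardy_orlicz_def intro: holomorphic_on_imp_continuous_on)
    then have "disc_ext f \<in> borel_measurable \<mu>" by (rule disc_ext_measurable[OF sets])
    \<comment> \<open>Adding 1 gives a positive constant above the norm even if the norm is
      0.\<close>
    moreover have "0 < hardy_norm \<Psi>1 f + 1" using nonneg[OF f] by simp
    ultimately show "in_orlicz \<Psi>2 \<mu> (disc_ext f)"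
      unfolding in_orlicz_def using main[OF f, of "hardy_norm \<Psi>1 f + 1"] D
      by (intro conjI exI[of _ "(hardy_norm \<Psi>1 f + 1) * D"]) auto
    show "lux_norm \<Psi>2 \<mu> (disc_ext f) \<le> D * hardy_norm \<Psi>1 f"
    \<comment> \<open>The bound holds for every constant strictly above the Hardy norm, so it passes
      to the norm itself, zero included.\<close>
    proof (rule dense_ge)
      fix y assume y: "D * hardy_norm \<Psi>1 f < y"
      then have C: "hardy_norm \<Psi>1 f < y / D" using D by (simp add: field_simps)
      moreover have "0 < y / D" using nonneg[OF f] C by linarith
      ultimately have "lux_norm \<Psi>2 \<mu> (disc_ext f) \<le> y / D * D"
        using D by (intro lux_norm_le main[OF f] mult_pos_pos) auto
      then show "lux_norm \<Psi>2 \<mu> (disc_ext f) \<le> y" using D by simp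
    qed
  qed
qed

theorem mainTheorem10:
  fixes \<mu> :: "complex measure" and \<Psi>1 \<Psi>2 :: "real \<Rightarrow> real"
  assumes "finite_measure \<mu>"
    and "sets \<mu> = sets (restrict_space borel (cball (0::complex) 1))"
    and "orlicz \<Psi>1" and "orlicz \<Psi>2"
  shows "(hardy_orlicz_embeds \<Psi>1 \<Psi>2 \<mu> \<longrightarrow>
            (\<exists>A>0. \<forall>h\<in>{0<..1}. rho_mu \<mu> h \<le> 1 / \<Psi>2 (A * orlicz_inv \<Psi>1 (1 / h))))
       \<and> ((\<exists>A>0. \<forall>h\<in>{0<..1}. K_mu \<mu> h \<le> ereal ((1 / h) / \<Psi>2 (A * orlicz_inv \<Psi>1 (1 / h))))
            \<longrightarrow> hardy_orlicz_embeds \<Psi>1 \<Psi>2 \<mu>)"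
  using rho_mu_le_of_embeds[OF assms] hardy_orlicz_embeds_of_K_mu[OF assms] by blast

end
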